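(* Let $n\ge 1$. (Part A) Let $w\in B_{2,n}$ be a product of $k\ge 1$ loopings taken from $\{\mathcal{T}_i^{\pm1},\tau_i^{\pm1} : i=1,\dots,n\}$, and let $m$ and $M$ be the minimum and maximum index of the loopings occurring in this product. Then, as an element of $\mathrm{H}_{2,n}(q)$, $w$ can be written as a finite $\mathbb{Z}[q^{\pm1}]$-linear combination of elements of the form $w'G$ such that: (i) each $w'$ is the image in $\mathrm{H}_{2,n}(q)$ of a braid in $B_{2,n}$ which is written as a product of $k$ loopings from $\{\mathcal{T}_i^{\pm1},\tau_i^{\pm1} : i=1,\dots,n\}$; (ii) the index of each looping in $w'$ lies in the interval $[m,M]$; (iii) the indices of the loopings in $w'$ increase (in the weak sense, i.e. are non-decreasing) from left to right; (iv) each $G$ is a finite product of elements $g_i^{\pm1}$ with $i\in[m,M-1]$ if $m<M$, and $G=1$ if $m=M$. (Part B) Every element of $\mathrm{H}_{2,n}(q)$ can be written as a finite $\mathbb{Z}[q^{\pm1}]$-linear combination of elements of the form $$\Pi_1\Pi_2\cdots\Pi_n\,G,$$ where $G$ is a finite product of the braiding generators $g_1,\dots,g_{n-1}$ and, for each $i=1,\dots,n$, $\Pi_i$ is a finite product of only the loopings $\mathcal{T}_i,\tau_i,\mathcal{T}_i^{-1},\tau_i^{-1}$. Thus the set $$\Lambda_n:=\{\Pi_1\Pi_2\cdots\Pi_n G \;:\; G \text{ a finite product of braiding generators},\ \Pi_i \text{ a finite product of only the loopings } \mathcal{T}_i,\tau_i,\mathcal{T}_i^{-1},\tau_i^{-1}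 \text{ for all } i\}$$ spans $\mathrm{H}_{2,n}(q)$ as a $\mathbb{Z}[q^{\pm1}]$-module.
   Context: The mixed braid group $B_{2,n}$ on two fixed strands is the group of braids on $n+2$ strands whose first two strands are identically straight. It is presented by generators $\mathcal{T},\tau,\sigma_1,\dots,\sigma_{n-1}$ and relations (whenever the generators involved exist): - $\sigma_k\sigma_j=\sigma_j\sigma_k$ for $|k-j|>1$; - $\sigma_k\sigma_{k+1}\sigma_k=\sigma_{k+1}\sigma_k\sigma_{k+1}$ for $1\le k\le n-2$; - $\mathcal{T}\sigma_k=\sigma_k\mathcal{T}$ and $\tau\sigma_k=\sigma_k\tau$ for $k\ge2$; - $\mathcal{T}\sigma_1\mathcal{T}\sigma_1=\sigma_1\mathcal{T}\sigma_1\mathcal{T}$; - $\tau\sigma_1\tau\sigma_1=\sigma_1\tau\sigma_1\tau$; - $\tau(\sigma_1\mathcal{T}\sigma_1)=(\sigma_1\mathcal{T}\sigma_1)\tau$. With $q$ a variable, the mixed Hecke algebra on two fixed strands is the unital associative $\mathbb{Z}[q^{\pm1}]$-algebra $$\mathrm{H}_{2,n}(q):=\mathbb{Z}[q^{\pm1}]B_{2,n}\big/\big\langle \sigma_i^2-(q-1)\sigma_i-q\cdot 1,\ i=1,\dots,n-1\big\rangle .$$ The image of $\sigma_i$ in $\mathrm{H}_{2,n}(q)$ is denoted $g_i$ (the braiding generators of the algebra; each $g_i$ is invertible). Other elements of $B_{2,n}$ are denoted by the same symbols when regarded as elements of $\mathrm{H}_{2,n}(q)$. Looping elements (loopings): $\mathcal{T}_1:=\mathcal{T}$,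 $\tau_1:=\tau$, and for $1<i\le n$ $$\mathcal{T}_i:=\sigma_{i-1}\cdots\sigma_1\,\mathcal{T}\,\sigma_1\cdots\sigma_{i-1},\qquad \tau_i:=\sigma_{i-1}\cdots\sigma_1\,\tau\,\sigma_1\cdots\sigma_{i-1}.$$ The loopings are the elements $\mathcal{T}_i^{\pm1},\tau_i^{\pm1}$, $1\le i\le n$, and their index is $i$. Finite products may be empty (equal to $1$). *)

theory Defs
  imports
    "HOL-Library.Poly_Mapping"
    "HOL-Algebra.QuotRing"
    "Jordan_Normal_Form.VS_Connect"
begin

section \<open>Groups given by generators and relations\<close>

text \<open>A letter \<open>(x, True)\<close> stands for the generator \<open>x\<close>, and \<open>(x, False)\<close> for its inverse.\<close>

type_synonym 'x word = "('x \<times> bool) list"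

definition words :: "'x set \<Rightarrow> 'x word set" where
  "words X = lists (X \<times> UNIV)"

inductive word_eq :: "'x set \<Rightarrow> ('x word \<times> 'x word) set \<Rightarrow> 'x word \<Rightarrow> 'x word \<Rightarrow> bool"
  for X :: "'x set" and R :: "('x word \<times> 'x word) set" where
  refl: "u \<in> words X \<Longrightarrow> word_eq X R u u"
| sym: "word_eq X R u v \<Longrightarrow> word_eq X R v u"
| trans: "word_eq X R u v \<Longrightarrow> word_eq X R v w \<Longrightarrow> word_eq X R u w"
| ctxt: "word_eq X R u v \<Longrightarrow> a \<in> words X \<Longrightarrow> b \<in> words X \<Longrightarrow>
           word_eq X R (a @ u @ b) (a @ v @ b)"
| cancel: "x \<in> X \<Longrightarrow> word_eq X R [(x, e), (x, \<not> e)] []"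
| rel: "(u, v) \<in> R \<Longrightarrow> u \<in> words X \<Longrightarrow> v \<in> words X \<Longrightarrow> word_eq X R u v"

definition word_class :: "'x set \<Rightarrow> ('x word \<times> 'x word) set \<Rightarrow> 'x word \<Rightarrow> 'x word set" where
  "word_class X R u = {v. word_eq X R u v}"

definition presented_group :: "'x set \<Rightarrow> ('x word \<times> 'x word) set \<Rightarrow> 'x word set monoid" where
  "presented_group X R =
     \<lparr> carrier = word_class X R ` words X,
       mult = (\<lambda>A B. \<Union>a\<in>A. \<Union>b\<in>B. word_class X R (a @ b)),
       one = word_class X R [] \<rparr>"

lemma words_append [simp]: "u @ v \<in> words X \<longleftrightarrow> u \<in> words X \<and> v \<in> words X"
  by (auto simp: words_def)

lemma words_Nil [simp]: "[] \<in> words X"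
  by (auto simp: words_def)

lemma words_Cons [simp]: "(x, e) # u \<in> words X \<longleftrightarrow> x \<in> X \<and> u \<in> words X"
  by (auto simp: words_def)

lemma word_eq_words: "word_eq X R u v \<Longrightarrow> u \<in> words X \<and> v \<in> words X"
  by (induction rule: word_eq.induct) auto

lemma word_class_eq_iff:
  assumes "u \<in> words X"
  shows "word_class X R u = word_class X R v \<longleftrightarrow> word_eq X R u v"
proof
  assume "word_class X R u = word_class X R v"
  moreover have "u \<in> word_class X R u"
    using assms by (simp add: word_class_def word_eq.refl)
  ultimately show "word_eq X R u v"
    by (simp add: word_class_def word_eq.sym)
next
  assume "word_eq X R u v"
  then show "word_class X R u = word_class X R v"
    unfolding word_class_def
    using word_eq.trans[of X R u v] word_eq.trans[of X R v u] word_eq.sym[of X R u v] by auto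
qed

lemma word_eq_append:
  assumes "word_eq X R u u'" "word_eq X R v v'"
  shows "word_eq X R (u @ v) (u' @ v')"
proof -
  have "word_eq X R ([] @ u @ v) ([] @ u' @ v)"
    using assms word_eq_words by (intro word_eq.ctxt) auto
  moreover have "word_eq X R (u' @ v @ []) (u' @ v' @ [])"
    using assms word_eq_words by (intro word_eq.ctxt) auto
  ultimately show ?thesis
    using word_eq.trans[of X R "u @ v" "u' @ v"] by simp
qed

lemma presented_group_mult:
  assumes "u \<in> words X" "v \<in> words X"
  shows "word_class X R u \<otimes>\<^bsub>presented_group X R\<^esub> word_class X R v = word_class X R (u @ v)"
proof -
  have "word_class X R (a @ b) = word_class X R (u @ v)"
    if "a \<in> word_class X R u" "b \<in> word_class X R v" for a b
  proof -
    have "word_eq X R (u @ v) (a @ b)"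
      using that by (simp add: word_class_def word_eq_append)
    then show ?thesis
      using assms word_class_eq_iff[of "u @ v" X R "a @ b"] by simp
  qed
  then have "(\<Union>a\<in>word_class X R u. \<Union>b\<in>word_class X R v. word_class X R (a @ b)) =
      (\<Union>a\<in>word_class X R u. \<Union>b\<in>word_class X R v. word_class X R (u @ v))"
    by (intro SUP_cong) simp_all
  also have "\<dots> = word_class X R (u @ v)"
  proof -
    have "u \<in> word_class X R u" "v \<in> word_class X R v"
      using assms by (simp_all add: word_class_def word_eq.refl)
    then show ?thesis by blast
  qed
  finally show ?thesis
    by (simp add: presented_group_def)
qed

definition inverse_word :: "'x word \<Rightarrow> 'x word" where
  "inverse_word u = rev (map (\<lambda>(x, e). (x, \<not> e)) u)"

lemma inverse_word_words [simp]: "inverse_word u \<in> words X \<longleftrightarrow> u \<in> words X"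
  unfolding inverse_word_def words_def by (induction u) auto

lemma word_eq_inverse_left:
  "u \<in> words X \<Longrightarrow> word_eq X R (inverse_word u @ u) []"
proof (induction u)
  case Nil
  then show ?case by (simp add: inverse_word_def word_eq.refl)
next
  case (Cons l u)
  obtain x e where l: "l = (x, e)" by (cases l)
  with Cons have x: "x \<in> X" and u: "u \<in> words X" by auto
  have "word_eq X R (inverse_word u @ [(x, \<not> e), (x, \<not> \<not> e)] @ u) (inverse_word u @ [] @ u)"
    using x u by (intro word_eq.ctxt word_eq.cancel) auto
  then have "word_eq X R (inverse_word (l # u) @ (l # u)) (inverse_word u @ u)"
    by (simp add: l inverse_word_def)
  with Cons.IH[OF u] show ?case by (rule word_eq.trans[rotated])
qed

lemma group_presented_group: "group (presented_group X R)"
proof -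
  let ?G = "presented_group X R"
  have carr: "carrier ?G = word_class X R ` words X" and one: "\<one>\<^bsub>?G\<^esub> = word_class X R []"
    by (simp_all add: presented_group_def)
  show ?thesis
  proof (rule groupI)
    fix x y z assume "x \<in> carrier ?G" "y \<in> carrier ?G" "z \<in> carrier ?G"
    then show "x \<otimes>\<^bsub>?G\<^esub> y \<otimes>\<^bsub>?G\<^esub> z = x \<otimes>\<^bsub>?G\<^esub> (y \<otimes>\<^bsub>?G\<^esub> z)"
      by (auto simp: carr presented_group_mult)
  next
    fix x assume "x \<in> carrier ?G"
    then obtain u where u: "u \<in> words X" "x = word_class X R u" by (auto simp: carr)
    then have "word_class X R (inverse_word u) \<otimes>\<^bsub>?G\<^esub> x = \<one>\<^bsub>?G\<^esub>"
      by (simp add: one presented_group_mult word_class_eq_iff word_eq_inverse_left)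
    with u show "\<exists>y\<in>carrier ?G. y \<otimes>\<^bsub>?G\<^esub> x = \<one>\<^bsub>?G\<^esub>"
      by (intro bexI[of _ "word_class X R (inverse_word u)"]) (auto simp: carr)
  qed (auto simp: carr one presented_group_mult)
qed


section \<open>Group algebras and quotient algebras\<close>

definition group_algebra ::
  "('g, 'z) monoid_scheme \<Rightarrow> ('r::comm_ring_1, 'g \<Rightarrow>\<^sub>0 'r) module" where
  "group_algebra G =
     \<lparr> carrier = {f. Poly_Mapping.keys f \<subseteq> carrier G},
       mult = (\<lambda>f g. \<Sum>a\<in>Poly_Mapping.keys f. \<Sum>b\<in>Poly_Mapping.keys g.
                 Poly_Mapping.single (a \<otimes>\<^bsub>G\<^esub> b) (Poly_Mapping.lookup f a * Poly_Mapping.lookup g b)),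
       one = Poly_Mapping.single \<one>\<^bsub>G\<^esub> 1,
       zero = 0,
       add = (+),
       smult = (\<lambda>c f. Poly_Mapping.map ((*) c) f) \<rparr>"

definition quotient_algebra :: "('r, 'a, 'z) module_scheme \<Rightarrow> 'a set \<Rightarrow> ('r, 'a set) module" where
  "quotient_algebra A I =
     \<lparr> carrier = carrier (A Quot I),
       mult = mult (A Quot I),
       one = one (A Quot I),
       zero = zero (A Quot I),
       add = add (A Quot I),
       smult = (\<lambda>c X. \<Union>x\<in>X. I +>\<^bsub>A\<^esub> (c \<odot>\<^bsub>A\<^esub> x)) \<rparr>"

lemma lookup_map_mult [simp]:
  "Poly_Mapping.lookup (Poly_Mapping.map ((*) c) f) k = (c :: 'r::comm_ring_1) * Poly_Mapping.lookup f k"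
  by (simp add: Poly_Mapping.map.rep_eq when_def)

lemma keys_map_mult: "Poly_Mapping.keys (Poly_Mapping.map ((*) (c :: 'r::comm_ring_1)) f) \<subseteq> Poly_Mapping.keys f"
  by (auto simp: in_keys_iff)

lemma group_algebra_mult_superset:
  fixes f h :: "'g \<Rightarrow>\<^sub>0 'r::comm_ring_1"
  assumes "finite A" "Poly_Mapping.keys f \<subseteq> A" "finite B" "Poly_Mapping.keys h \<subseteq> B"
  shows "f \<otimes>\<^bsub>group_algebra G\<^esub> h =
    (\<Sum>a\<in>A. \<Sum>b\<in>B. Poly_Mapping.single (a \<otimes>\<^bsub>G\<^esub> b) (Poly_Mapping.lookup f a * Poly_Mapping.lookup h b))"
proof -
  have "(\<Sum>b\<in>Poly_Mapping.keys h. Poly_Mapping.single (a \<otimes>\<^bsub>G\<^esub> b) (Poly_Mapping.lookup f a * Poly_Mapping.lookup h b))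
      = (\<Sum>b\<in>B. Poly_Mapping.single (a \<otimes>\<^bsub>G\<^esub> b) (Poly_Mapping.lookup f a * Poly_Mapping.lookup h b))" for a
    using assms by (intro sum.mono_neutral_left) (auto simp: in_keys_iff)
  then have "f \<otimes>\<^bsub>group_algebra G\<^esub> h = (\<Sum>a\<in>Poly_Mapping.keys f. \<Sum>b\<in>B.
      Poly_Mapping.single (a \<otimes>\<^bsub>G\<^esub> b) (Poly_Mapping.lookup f a * Poly_Mapping.lookup h b))"
    by (simp add: group_algebra_def)
  also have "\<dots> = (\<Sum>a\<in>A. \<Sum>b\<in>B.
      Poly_Mapping.single (a \<otimes>\<^bsub>G\<^esub> b) (Poly_Mapping.lookup f a * Poly_Mapping.lookup h b))"
    using assms by (intro sum.mono_neutral_left) (auto simp: in_keys_iff)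
  finally show ?thesis .
qed

lemma group_algebra_distrib:
  fixes f f' h :: "'g \<Rightarrow>\<^sub>0 'r::comm_ring_1"
  shows "(f + f') \<otimes>\<^bsub>group_algebra G\<^esub> h = f \<otimes>\<^bsub>group_algebra G\<^esub> h + f' \<otimes>\<^bsub>group_algebra G\<^esub> h"
    and "h \<otimes>\<^bsub>group_algebra G\<^esub> (f + f') = h \<otimes>\<^bsub>group_algebra G\<^esub> f + h \<otimes>\<^bsub>group_algebra G\<^esub> f'"
proof -
  let ?A = "Poly_Mapping.keys f \<union> Poly_Mapping.keys f'" and ?B = "Poly_Mapping.keys h"
  have sub: "Poly_Mapping.keys (f + f') \<subseteq> ?A" by (rule keys_add)
  show "(f + f') \<otimes>\<^bsub>group_algebra G\<^esub> h = f \<otimes>\<^bsub>group_algebra G\<^esub> h + f' \<otimes>\<^bsub>group_algebra G\<^esub> h"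
    using sub
    by (simp add: group_algebra_mult_superset[where A = ?A and B = ?B]
        lookup_add distrib_right single_add sum.distrib)
  show "h \<otimes>\<^bsub>group_algebra G\<^esub> (f + f') = h \<otimes>\<^bsub>group_algebra G\<^esub> f + h \<otimes>\<^bsub>group_algebra G\<^esub> f'"
    using sub
    by (simp add: group_algebra_mult_superset[where A = ?B and B = ?A]
        lookup_add distrib_left single_add sum.distrib)
qed

lemma group_algebra_mult_zero [simp]:
  fixes h :: "'g \<Rightarrow>\<^sub>0 'r::comm_ring_1"
  shows "0 \<otimes>\<^bsub>group_algebra G\<^esub> h = 0" "h \<otimes>\<^bsub>group_algebra G\<^esub> 0 = 0"
  by (simp_all add: group_algebra_def)

lemma group_algebra_mult_sum:
  fixes h :: "'g \<Rightarrow>\<^sub>0 'r::comm_ring_1"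
  shows "(\<Sum>i\<in>S. F i) \<otimes>\<^bsub>group_algebra G\<^esub> h = (\<Sum>i\<in>S. F i \<otimes>\<^bsub>group_algebra G\<^esub> h)"
    and "h \<otimes>\<^bsub>group_algebra G\<^esub> (\<Sum>i\<in>S. F i) = (\<Sum>i\<in>S. h \<otimes>\<^bsub>group_algebra G\<^esub> F i)"
  by (induction S rule: infinite_finite_induct) (simp_all add: group_algebra_distrib)

lemma group_algebra_mult_single:
  fixes c d :: "'r::comm_ring_1"
  shows "Poly_Mapping.single a c \<otimes>\<^bsub>group_algebra G\<^esub> Poly_Mapping.single b d =
    Poly_Mapping.single (a \<otimes>\<^bsub>G\<^esub> b) (c * d)"
  by (subst group_algebra_mult_superset[of "{a}" _ "{b}"]) auto

lemma poly_mapping_sum_single: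
  fixes f :: "'g \<Rightarrow>\<^sub>0 'r::comm_ring_1"
  shows "f = (\<Sum>a\<in>Poly_Mapping.keys f. Poly_Mapping.single a (Poly_Mapping.lookup f a))"
  by (rule poly_mapping_eqI) (simp add: lookup_sum lookup_single when_def in_keys_iff)

lemma group_algebra_carrier_induct [consumes 1, case_names zero single add]:
  fixes f :: "'g \<Rightarrow>\<^sub>0 'r::comm_ring_1"
  assumes "f \<in> carrier (group_algebra G)"
    and zero: "P 0"
    and single: "\<And>a c. a \<in> carrier G \<Longrightarrow> P (Poly_Mapping.single a c)"
    and add: "\<And>f h. P f \<Longrightarrow> P h \<Longrightarrow> P (f + h)"
  shows "P f"
proof -
  have "P (\<Sum>a\<in>S. Poly_Mapping.single a (Poly_Mapping.lookup f a))"
    if "finite S" "S \<subseteq> carrier G" for S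
    using that by (induction S rule: finite_induct) (auto intro: zero single add)
  moreover have "Poly_Mapping.keys f \<subseteq> carrier G"
    using assms(1) by (simp add: group_algebra_def)
  ultimately show ?thesis
    by (subst poly_mapping_sum_single) simp
qed

lemma group_algebra_add_closed:
  "f \<in> carrier (group_algebra G) \<Longrightarrow> h \<in> carrier (group_algebra G) \<Longrightarrow>
     f + h \<in> carrier (group_algebra G)"
  using keys_add[of f h] by (auto simp: group_algebra_def)

lemma ring_group_algebra:
  assumes "monoid G"
  shows "ring (group_algebra G :: ('r::comm_ring_1, 'g \<Rightarrow>\<^sub>0 'r) module)"
proof -
  interpret G: monoid G by fact
  let ?A = "group_algebra G :: ('r, 'g \<Rightarrow>\<^sub>0 'r) module"
  have add: "f \<oplus>\<^bsub>?A\<^esub> h = f + h" and zero: "\<zero>\<^bsub>?A\<^esub> = 0"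
    and one: "\<one>\<^bsub>?A\<^esub> = Poly_Mapping.single \<one>\<^bsub>G\<^esub> 1" for f h
    by (simp_all add: group_algebra_def)
  have zero_in: "0 \<in> carrier ?A" and single_in: "a \<in> carrier G \<Longrightarrow> Poly_Mapping.single a c \<in> carrier ?A" for a c
    by (simp_all add: group_algebra_def)
  show ?thesis
  proof (rule ringI)
    show "abelian_group ?A"
    proof (rule abelian_groupI)
      fix x assume x: "x \<in> carrier ?A"
      then have "- x \<in> carrier ?A"
        by (auto simp: group_algebra_def in_keys_iff subset_iff)
      then show "\<exists>y\<in>carrier ?A. y \<oplus>\<^bsub>?A\<^esub> x = \<zero>\<^bsub>?A\<^esub>"
        by (intro bexI[of _ "- x"]) (simp_all add: add zero)
    qed (simp_all add: add zero zero_in group_algebra_add_closed ac_simps)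
  next
    show "Group.monoid ?A"
    proof (rule monoidI)
      fix x y assume x: "x \<in> carrier ?A" and y: "y \<in> carrier ?A"
      from x show "x \<otimes>\<^bsub>?A\<^esub> y \<in> carrier ?A"
      proof (induction rule: group_algebra_carrier_induct)
        case (single a c)
        from y show ?case
          by (induction rule: group_algebra_carrier_induct)
            (simp_all add: group_algebra_mult_single group_algebra_distrib single single_in
              zero_in group_algebra_add_closed)
      qed (simp_all add: group_algebra_distrib zero_in group_algebra_add_closed)
    next
      show "\<one>\<^bsub>?A\<^esub> \<in> carrier ?A" by (simp add: one single_in)
    next
      fix x y z assume x: "x \<in> carrier ?A" and y: "y \<in> carrier ?A" and z: "z \<in> carrier ?A"
      from x show "x \<otimes>\<^bsub>?A\<^esub> y \<otimes>\<^bsub>?A\<^esub> z = x \<otimes>\<^bsub>?A\<^esub> (y \<otimes>\<^bsub>?A\<^esub> z)"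
      proof (induction rule: group_algebra_carrier_induct)
        case (single a c)
        note a = single
        from y show ?case
        proof (induction rule: group_algebra_carrier_induct)
          case (single b d)
          note b = single
          from z show ?case
            by (induction rule: group_algebra_carrier_induct)
              (simp_all add: group_algebra_mult_single group_algebra_distrib a b G.m_assoc mult.assoc)
        qed (simp_all add: group_algebra_distrib)
      qed (simp_all add: group_algebra_distrib)
    next
      fix x assume x: "x \<in> carrier ?A"
      from x show "\<one>\<^bsub>?A\<^esub> \<otimes>\<^bsub>?A\<^esub> x = x"
        by (induction rule: group_algebra_carrier_induct)
          (simp_all add: one group_algebra_mult_single group_algebra_distrib)
      from x show "x \<otimes>\<^bsub>?A\<^esub> \<one>\<^bsub>?A\<^esub> = x"
        by (induction rule: group_algebra_carrier_induct)
          (simp_all add: one group_algebra_mult_single group_algebra_distrib)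
    qed
  qed (simp_all add: add group_algebra_distrib)
qed

lemma group_algebra_smult_mult:
  fixes f h :: "'g \<Rightarrow>\<^sub>0 'r::comm_ring_1"
  shows "(c \<odot>\<^bsub>group_algebra G\<^esub> f) \<otimes>\<^bsub>group_algebra G\<^esub> h = c \<odot>\<^bsub>group_algebra G\<^esub> (f \<otimes>\<^bsub>group_algebra G\<^esub> h)"
proof -
  have "(c \<odot>\<^bsub>group_algebra G\<^esub> f) \<otimes>\<^bsub>group_algebra G\<^esub> h =
    (\<Sum>a\<in>Poly_Mapping.keys f. \<Sum>b\<in>Poly_Mapping.keys h.
       Poly_Mapping.single (a \<otimes>\<^bsub>G\<^esub> b) (c * (Poly_Mapping.lookup f a * Poly_Mapping.lookup h b)))"
    by (subst group_algebra_mult_superset[of "Poly_Mapping.keys f" _ "Poly_Mapping.keys h"])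
      (simp_all add: group_algebra_def keys_map_mult mult.assoc)
  also have "\<dots> = c \<odot>\<^bsub>group_algebra G\<^esub> (f \<otimes>\<^bsub>group_algebra G\<^esub> h)"
    by (rule poly_mapping_eqI)
      (simp add: group_algebra_def lookup_sum lookup_single sum_distrib_left mult_when)
  finally show ?thesis .
qed

lemma module_group_algebra:
  assumes "monoid G"
  shows "Module.module class_ring (group_algebra G :: ('r::comm_ring_1, 'g \<Rightarrow>\<^sub>0 'r) module)"
proof -
  interpret A: ring "group_algebra G :: ('r, 'g \<Rightarrow>\<^sub>0 'r) module"
    using assms by (rule ring_group_algebra)
  show ?thesis
  proof (rule moduleI)
    show "cring (class_ring :: 'r ring)"
      by (rule class_cring.is_cring)
    show "abelian_group (group_algebra G :: ('r, 'g \<Rightarrow>\<^sub>0 'r) module)"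
      by (rule A.is_abelian_group)
  qed (use keys_map_mult in \<open>fastforce simp: group_algebra_def lookup_add algebra_simps
        intro!: poly_mapping_eqI\<close>)+
qed

lemma quotient_algebra_props:
  fixes A :: "('r, 'a, 'z) module_scheme"
  assumes "ring A" "Module.module R A" "ideal I A"
    and assoc: "\<And>c x y. \<lbrakk>c \<in> carrier R; x \<in> carrier A; y \<in> carrier A\<rbrakk> \<Longrightarrow>
      (c \<odot>\<^bsub>A\<^esub> x) \<otimes>\<^bsub>A\<^esub> y = c \<odot>\<^bsub>A\<^esub> (x \<otimes>\<^bsub>A\<^esub> y)"
  shows quotient_algebra_ring: "ring (quotient_algebra A I)"
    and quotient_algebra_module: "Module.module R (quotient_algebra A I)"
    and quotient_algebra_smult: "\<And>c x. \<lbrakk>c \<in> carrier R; x \<in> carrier A\<rbrakk> \<Longrightarrow>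
      c \<odot>\<^bsub>quotient_algebra A I\<^esub> (I +>\<^bsub>A\<^esub> x) = I +>\<^bsub>A\<^esub> (c \<odot>\<^bsub>A\<^esub> x)"
proof -
  interpret A: ring A by fact
  interpret M: Module.module R A by fact
  interpret I: ideal I A by fact
  let ?Q = "quotient_algebra A I"
  interpret Q: ring "A Quot I" by (rule I.quotient_is_ring)
  have Q: "carrier ?Q = carrier (A Quot I)" "mult ?Q = mult (A Quot I)" "one ?Q = one (A Quot I)"
      "zero ?Q = zero (A Quot I)" "add ?Q = add (A Quot I)"
    by (simp_all add: quotient_algebra_def)
  show ring: "ring ?Q"
  proof (rule ringI)
    show "abelian_group ?Q"
      by (rule abelian_groupI) (auto simp: Q Q.a_ac intro!: bexI[OF _ Q.a_inv_closed] Q.l_neg)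
    show "Group.monoid ?Q"
      by (rule monoidI) (auto simp: Q Q.m_assoc)
  qed (simp_all add: Q Q.l_distr Q.r_distr)
  have carr: "carrier ?Q = (\<lambda>x. I +>\<^bsub>A\<^esub> x) ` carrier A"
    by (auto simp: quotient_algebra_def FactRing_def A_RCOSETS_def' a_r_coset_def')
  have add: "(I +>\<^bsub>A\<^esub> x) \<oplus>\<^bsub>?Q\<^esub> (I +>\<^bsub>A\<^esub> y) = I +>\<^bsub>A\<^esub> (x \<oplus>\<^bsub>A\<^esub> y)"
    if "x \<in> carrier A" "y \<in> carrier A" for x y
    using that by (simp add: quotient_algebra_def FactRing_def I.a_rcos_sum)
  have smult_I: "c \<odot>\<^bsub>A\<^esub> i \<in> I" if "c \<in> carrier R" "i \<in> I" for c i
  proof -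
    have i: "i \<in> carrier A" using that I.Icarr by blast
    have "(c \<odot>\<^bsub>A\<^esub> \<one>\<^bsub>A\<^esub>) \<otimes>\<^bsub>A\<^esub> i \<in> I"
      using that by (intro I.I_l_closed) auto
    then show ?thesis using that i by (simp add: assoc)
  qed
  show smult: "c \<odot>\<^bsub>?Q\<^esub> (I +>\<^bsub>A\<^esub> x) = I +>\<^bsub>A\<^esub> (c \<odot>\<^bsub>A\<^esub> x)"
    if c: "c \<in> carrier R" and x: "x \<in> carrier A" for c x
  proof -
    have "I +>\<^bsub>A\<^esub> (c \<odot>\<^bsub>A\<^esub> y) = I +>\<^bsub>A\<^esub> (c \<odot>\<^bsub>A\<^esub> x)" if y: "y \<in> I +>\<^bsub>A\<^esub> x" for y
    proof -
      obtain i where i: "i \<in> I" "y = i \<oplus>\<^bsub>A\<^esub> x"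
        using y by (auto simp: a_r_coset_def')
      then have "c \<odot>\<^bsub>A\<^esub> y = c \<odot>\<^bsub>A\<^esub> i \<oplus>\<^bsub>A\<^esub> c \<odot>\<^bsub>A\<^esub> x"
        using c x I.Icarr by (simp add: M.smult_r_distr)
      then have "c \<odot>\<^bsub>A\<^esub> y \<in> I +>\<^bsub>A\<^esub> (c \<odot>\<^bsub>A\<^esub> x)"
        using smult_I[OF c i(1)] by (auto simp: a_r_coset_def')
      then show ?thesis
        using A.a_repr_independence[OF _ M.smult_closed[OF c x] I.a_subgroup] by simp
    qed
    then have "(\<Union>y\<in>I +>\<^bsub>A\<^esub> x. I +>\<^bsub>A\<^esub> (c \<odot>\<^bsub>A\<^esub> y)) =
        (\<Union>y\<in>I +>\<^bsub>A\<^esub> x. I +>\<^bsub>A\<^esub> (c \<odot>\<^bsub>A\<^esub> x))"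
      by (intro SUP_cong) simp_all
    also have "\<dots> = I +>\<^bsub>A\<^esub> (c \<odot>\<^bsub>A\<^esub> x)"
      using I.a_rcos_self[OF x] by blast
    finally show ?thesis
      by (simp add: quotient_algebra_def)
  qed
  show "Module.module R ?Q"
  proof (rule moduleI)
    show "abelian_group ?Q" using ring by (rule ring.is_abelian_group)
    show "cring R" by (rule M.R.is_cring)
  qed (auto simp: carr add smult M.smult_l_distr M.smult_r_distr M.smult_assoc1)
qed

definition list_prod :: "('a, 'z) monoid_scheme \<Rightarrow> 'a list \<Rightarrow> 'a" where
  "list_prod G xs = foldr (mult G) xs \<one>\<^bsub>G\<^esub>"


section \<open>The mixed braid group and the mixed Hecke algebra on two fixed strands\<close>

text \<open>\<open>TT\<close> stands for the loop generator written as calligraphic T, \<open>Tau\<close> for \<open>\<tau>\<close>, and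
  \<open>Sig k\<close> for \<open>\<sigma>\<^sub>k\<close>.\<close>

datatype fixed_loop = TT | Tau

datatype mixed_gen = Loop fixed_loop | Sig nat

definition mixed_gens :: "nat \<Rightarrow> mixed_gen set" where
  "mixed_gens n = range Loop \<union> Sig ` {1..<n}"

definition mixed_rels :: "nat \<Rightarrow> (mixed_gen word \<times> mixed_gen word) set" where
  "mixed_rels n =
    (let \<sigma> = (\<lambda>k. (Sig k, True)); l = (\<lambda>a. (Loop a, True)) in
       {([\<sigma> k, \<sigma> j], [\<sigma> j, \<sigma> k]) | k j.
          k \<in> {1..<n} \<and> j \<in> {1..<n} \<and> \<bar>int k - int j\<bar> > 1}
     \<union> {([\<sigma> k, \<sigma> (k+1), \<sigma> k], [\<sigma> (k+1), \<sigma> k, \<sigma> (k+1)]) | k. 1 \<le> k \<and> k + 2 \<le> n}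
     \<union> {([l a, \<sigma> k], [\<sigma> k, l a]) | a k. 2 \<le> k \<and> k < n}
     \<union> {([l a, \<sigma> 1, l a, \<sigma> 1], [\<sigma> 1, l a, \<sigma> 1, l a]) | a. 1 < n}
     \<union> (if 1 < n then {([l Tau, \<sigma> 1, l TT, \<sigma> 1], [\<sigma> 1, l TT, \<sigma> 1, l Tau])} else {}))"

type_synonym mixed_braid = "mixed_gen word set"

definition mixed_braid_group :: "nat \<Rightarrow> mixed_braid monoid" where
  "mixed_braid_group n = presented_group (mixed_gens n) (mixed_rels n)"

definition braid_gen :: "nat \<Rightarrow> mixed_gen \<Rightarrow> mixed_braid" where
  "braid_gen n x = word_class (mixed_gens n) (mixed_rels n) [(x, True)]"

text \<open>Laurent polynomials in \<open>q\<close> over the integers: the group ring of the additive group of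
  integers, with \<open>q\<close> the basis element of exponent 1.\<close>

type_synonym laurent = "int \<Rightarrow>\<^sub>0 int"

definition hecke_q :: laurent where
  "hecke_q = Poly_Mapping.single 1 1"

definition braid_algebra :: "nat \<Rightarrow> (laurent, mixed_braid \<Rightarrow>\<^sub>0 laurent) module" where
  "braid_algebra n = group_algebra (mixed_braid_group n)"

definition of_braid :: "mixed_braid \<Rightarrow> (mixed_braid \<Rightarrow>\<^sub>0 laurent)" where
  "of_braid b = Poly_Mapping.single b 1"

definition quadratic_elem :: "nat \<Rightarrow> nat \<Rightarrow> (mixed_braid \<Rightarrow>\<^sub>0 laurent)" where
  "quadratic_elem n i =
     (let A = braid_algebra n; s = of_braid (braid_gen n (Sig i))
      in s \<otimes>\<^bsub>A\<^esub> s \<ominus>\<^bsub>A\<^esub> (hecke_q - 1) \<odot>\<^bsub>A\<^esub> s \<ominus>\<^bsub>A\<^esub> hecke_q \<odot>\<^bsub>A\<^esub> \<one>\<^bsub>A\<^esub>)"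

definition hecke_ideal :: "nat \<Rightarrow> (mixed_braid \<Rightarrow>\<^sub>0 laurent) set" where
  "hecke_ideal n = Idl\<^bsub>braid_algebra n\<^esub> (quadratic_elem n ` {1..<n})"

type_synonym hecke_elem = "(mixed_braid \<Rightarrow>\<^sub>0 laurent) set"

definition mixed_hecke :: "nat \<Rightarrow> (laurent, hecke_elem) module" where
  "mixed_hecke n = quotient_algebra (braid_algebra n) (hecke_ideal n)"

definition hecke_image :: "nat \<Rightarrow> mixed_braid \<Rightarrow> hecke_elem" where
  "hecke_image n b = hecke_ideal n +>\<^bsub>braid_algebra n\<^esub> of_braid b"

definition braiding_gen :: "nat \<Rightarrow> nat \<Rightarrow> hecke_elem" where
  "braiding_gen n i = hecke_image n (braid_gen n (Sig i))"

lemma monoid_mixed_braid_group: "monoid (mixed_braid_group n)"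
  using group_presented_group unfolding mixed_braid_group_def by (rule group.is_monoid)

lemma ring_braid_algebra: "ring (braid_algebra n)"
  unfolding braid_algebra_def by (rule ring_group_algebra) (rule monoid_mixed_braid_group)

lemma module_braid_algebra: "Module.module class_ring (braid_algebra n)"
  unfolding braid_algebra_def by (rule module_group_algebra) (rule monoid_mixed_braid_group)

lemma braid_gen_closed:
  "x \<in> mixed_gens n \<Longrightarrow> braid_gen n x \<in> carrier (mixed_braid_group n)"
  by (auto simp: braid_gen_def mixed_braid_group_def presented_group_def)

lemma of_braid_closed:
  "b \<in> carrier (mixed_braid_group n) \<Longrightarrow> of_braid b \<in> carrier (braid_algebra n)"
  by (auto simp: of_braid_def braid_algebra_def group_algebra_def)

lemma ideal_hecke_ideal: "ideal (hecke_ideal n) (braid_algebra n)"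
proof -
  interpret A: ring "braid_algebra n" by (rule ring_braid_algebra)
  interpret M: Module.module class_ring "braid_algebra n" by (rule module_braid_algebra)
  have "quadratic_elem n i \<in> carrier (braid_algebra n)" if "i \<in> {1..<n}" for i
  proof -
    have "of_braid (braid_gen n (Sig i)) \<in> carrier (braid_algebra n)"
      using that by (intro of_braid_closed braid_gen_closed) (auto simp: mixed_gens_def)
    then show ?thesis
      unfolding quadratic_elem_def Let_def by (intro A.minus_closed A.m_closed M.smult_closed) auto
  qed
  then show ?thesis
    unfolding hecke_ideal_def by (intro A.genideal_ideal) blast
qed

lemma ring_mixed_hecke: "ring (mixed_hecke n)"
  and module_mixed_hecke: "Module.module class_ring (mixed_hecke n)"
  unfolding mixed_hecke_def
  by (rule quotient_algebra_props[OF ring_braid_algebra module_braid_algebra ideal_hecke_ideal],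
      simp add: braid_algebra_def group_algebra_smult_mult)+

text \<open>\<open>hecke_span n S\<close> is the set of finite linear combinations of elements of \<open>S\<close> with
  Laurent polynomial coefficients.\<close>

abbreviation hecke_span :: "nat \<Rightarrow> hecke_elem set \<Rightarrow> hecke_elem set" where
  "hecke_span n S \<equiv> LinearCombinations.module.span class_ring (mixed_hecke n) S"


section \<open>Loopings\<close>

text \<open>\<open>Looping a i True\<close> names the \<open>i\<close>-th looping around the fixed strand \<open>a\<close>, and
  \<open>Looping a i False\<close> its inverse.\<close>

datatype looping = Looping (strand: fixed_loop) (index: nat) (positive: bool)

definition loopings :: "nat \<Rightarrow> looping set" where
  "loopings n = {l. index l \<in> {1..n}}"

definition looping_elem :: "nat \<Rightarrow> fixed_loop \<Rightarrow> nat \<Rightarrow> mixed_braid" where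
  "looping_elem n a i =
     list_prod (mixed_braid_group n)
       (map (\<lambda>j. braid_gen n (Sig j)) (rev [1..<i]) @ [braid_gen n (Loop a)] @
        map (\<lambda>j. braid_gen n (Sig j)) [1..<i])"

definition looping_braid :: "nat \<Rightarrow> looping \<Rightarrow> mixed_braid" where
  "looping_braid n l =
     (if positive l then looping_elem n (strand l) (index l)
      else inv\<^bsub>mixed_braid_group n\<^esub> looping_elem n (strand l) (index l))"

definition looping_prod :: "nat \<Rightarrow> looping list \<Rightarrow> mixed_braid" where
  "looping_prod n ls = list_prod (mixed_braid_group n) (map (looping_braid n) ls)"

definition braiding_prods :: "nat \<Rightarrow> nat set \<Rightarrow> hecke_elem set" where
  "braiding_prods n J = {list_prod (mixed_hecke n) (map (braiding_gen n) js) | js. set js \<subseteq> J}"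

definition signed_braiding_prods :: "nat \<Rightarrow> nat set \<Rightarrow> hecke_elem set" where
  "signed_braiding_prods n J =
     {list_prod (mixed_hecke n) (map (\<lambda>(j, e).
         if e then braiding_gen n j else inv\<^bsub>mixed_hecke n\<^esub> braiding_gen n j) js)
      | js. fst ` set js \<subseteq> J}"

definition Lambda :: "nat \<Rightarrow> hecke_elem set" where
  "Lambda n =
     {list_prod (mixed_hecke n) (map P [1..<n+1]) \<otimes>\<^bsub>mixed_hecke n\<^esub> G | P G.
        (\<forall>i\<in>{1..n}. \<exists>ls. index ` set ls \<subseteq> {i} \<and>
           P i = list_prod (mixed_hecke n) (map (hecke_image n \<circ> looping_braid n) ls)) \<and>
        G \<in> braiding_prods n {1..<n}}"

end

(* Loopings of different indices i > m commute, except for tau_i and T_m.  All rewriting happens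
   inside the braid group: "b reduces to S" means that the image of b lies in the span of the
   image of S, and the quadratic relation enters only as "sigma_k^{+-1} reduces to
   {sigma_k^{-+1}, 1}".  The identity
   sigma_m^-1 tau_m^e sigma_m T_m = T_m sigma_m tau_m^e sigma_m^-1 (and its variant for T_m^-1)
   sorts tau_i^e T_m^f whenever e = f.  If e = -f, write T_m^f as a combination of elements
   A T_m^f h and T_i^f h with A and h products of braiding generators, where A is chosen so that
   tau_i^e A T_m^f can be sorted.  This leaves the pair tau_i^e T_i^f; it is not reduced by itself,
   but the next letter of minimal index m can be moved in front of it.  Hence a word reduces to
   words that start with a letter of index m and words without letters of index m, and induction on
   the length and on the width of the index interval concludes. *)

theory Submission
  imports Defs "HOL-Algebra.Generated_Groups"
begin

text \<open>The obstacle is \<tau>_i to the left of T_m with i > m, for which the relations give no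
  commutation. Let i = m + 1 and write \<tau>_i^e T_m^f = \<sigma>_m^e \<tau>_m^e \<sigma>_m^e
  T_m^f. The flip identity needs \<sigma>_m^-f on the left and \<sigma>_m^f in the middle. If e = f,
  only the left letter is wrong, and changing its sign leaves the error term \<tau>_m^e \<sigma>_m^e
  T_m^f, which already starts with index m. If e = -f, the middle letter is wrong, and the error
  term is \<sigma>_m^e \<tau>_m^e T_m^f = \<tau>_i^e T_i^f \<sigma>_m^e: a pair without any letter
  of index m. This is why opposite signs need the rest of the word. The choice A = \<sigma>_m^(2f)
  repairs the middle letter. Moreover \<sigma>_m commutes with T_m^f T_i^f, so A can be inserted in
  front of this product, with its inverse behind, at no cost. This handles a letter T_m^f that
  arrives from the rest of the word; every other letter of index m forms a good pair with
  \<tau>_i^e. For larger i, A is conjugated by generators \<sigma>_j with j > m, which commute with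
  T_m.\<close>

section \<open>Commutation of loopings\<close>

context group begin

definition pw :: "'a \<Rightarrow> bool \<Rightarrow> 'a" where
  "pw a e = (if e then a else inv a)"

lemma pw_closed [simp, intro]: "a \<in> carrier G \<Longrightarrow> pw a e \<in> carrier G"
  by (simp add: pw_def)

lemma pw_cancel [simp]:
  assumes "a \<in> carrier G"
  shows "pw a e \<otimes> pw a (\<not> e) = \<one>" "pw a (\<not> e) \<otimes> pw a e = \<one>"
    "z \<in> carrier G \<Longrightarrow> pw a e \<otimes> (pw a (\<not> e) \<otimes> z) = z"
    "z \<in> carrier G \<Longrightarrow> pw a (\<not> e) \<otimes> (pw a e \<otimes> z) = z"
  using assms by (auto simp: pw_def m_assoc[symmetric])

lemma commute_inv:
  assumes "a \<otimes> b = b \<otimes> a" "a \<in> carrier G" "b \<in> carrier G"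
  shows "inv a \<otimes> b = b \<otimes> inv a"
  by (metis assms inv_closed inv_solve_left inv_solve_right m_assoc m_closed)

lemma commute_pw:
  assumes "a \<otimes> b = b \<otimes> a" "a \<in> carrier G" "b \<in> carrier G"
  shows "pw a e \<otimes> pw b f = pw b f \<otimes> pw a e"
  using assms commute_inv[of a b] commute_inv[of b a] commute_inv[of b "inv a"]
  by (auto simp: pw_def)

lemma commute_mult:
  assumes "a \<otimes> c = c \<otimes> a" "b \<otimes> c = c \<otimes> b"
    "a \<in> carrier G" "b \<in> carrier G" "c \<in> carrier G"
  shows "(a \<otimes> b) \<otimes> c = c \<otimes> (a \<otimes> b)"
  by (metis assms m_assoc)

end

text \<open>The relations of the mixed braid group for total families \<open>s\<close> and
  \<open>t\<close>, to be read with \<open>s k\<close> = 1 out of range. This explains the guards: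
  with \<open>s n\<close> = 1 the braid relation at k = n - 1 would force \<open>s (n - 1)\<close> =
  1, and for n = 1 the relation \<open>Tau_TT\<close> would make \<tau> and T commute.\<close>

locale mixed_braid_elems = group G for G (structure) +
  fixes n :: nat and s :: "nat \<Rightarrow> 'a" and t :: "fixed_loop \<Rightarrow> 'a"
  assumes s_closed [simp, intro]: "s k \<in> carrier G"
    and t_closed [simp, intro]: "t a \<in> carrier G"
    and s_far: "j + 1 < k \<Longrightarrow> s k \<otimes> s j = s j \<otimes> s k"
    and s_braid: "1 \<le> k \<Longrightarrow> k + 2 \<le> n \<Longrightarrow>
      s k \<otimes> (s (k + 1) \<otimes> s k) = s (k + 1) \<otimes> (s k \<otimes> s (k + 1))"
    and t_s: "2 \<le> k \<Longrightarrow> t a \<otimes> s k = s k \<otimes> t a"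
    and t_t: "1 < n \<Longrightarrow> t a \<otimes> (s 1 \<otimes> (t a \<otimes> s 1)) = s 1 \<otimes> (t a \<otimes> (s 1 \<otimes> t a))"
    and Tau_TT: "1 < n \<Longrightarrow> t Tau \<otimes> (s 1 \<otimes> (t TT \<otimes> s 1)) = s 1 \<otimes> (t TT \<otimes> (s 1 \<otimes> t Tau))"
begin

text \<open>\<open>lp a i\<close> is the looping of index \<open>i\<close>; the value at 0 is junk.\<close>

primrec lp :: "fixed_loop \<Rightarrow> nat \<Rightarrow> 'a" where
  "lp a 0 = t a"
| "lp a (Suc i) = (if i = 0 then t a else s i \<otimes> lp a i \<otimes> s i)"

definition X :: "looping \<Rightarrow> 'a" where
  "X l = pw (lp (strand l) (index l)) (positive l)"

definition sg :: "nat \<Rightarrow> bool \<Rightarrow> 'a" where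
  "sg k e = pw (s k) e"

abbreviation x :: "fixed_loop \<Rightarrow> nat \<Rightarrow> bool \<Rightarrow> 'a" where
  "x a i e \<equiv> X (Looping a i e)"

lemma lp_closed [simp, intro]: "lp a i \<in> carrier G"
  by (induction i) auto

lemma X_closed [simp, intro]: "X l \<in> carrier G"
  by (simp add: X_def)

lemma sg_closed [simp, intro]: "sg k e \<in> carrier G"
  by (simp add: sg_def)

lemma sg_cancel [simp]:
  "sg k e \<otimes> sg k (\<not> e) = \<one>" "sg k (\<not> e) \<otimes> sg k e = \<one>"
  "z \<in> carrier G \<Longrightarrow> sg k e \<otimes> (sg k (\<not> e) \<otimes> z) = z"
  "z \<in> carrier G \<Longrightarrow> sg k (\<not> e) \<otimes> (sg k e \<otimes> z) = z"
  by (auto simp: sg_def)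

text \<open>The inverse of \<sigma> T \<sigma> is \<sigma>^-1 T^-1 \<sigma>^-1, so one recursion
  serves both signs as long as the braiding letters carry the sign of the looping.\<close>

lemma X_Suc: "1 \<le> i \<Longrightarrow> x a (Suc i) e = sg i e \<otimes> (x a i e \<otimes> sg i e)"
  by (auto simp: X_def sg_def pw_def inv_mult_group m_assoc)

lemma sg_X_up: "1 \<le> i \<Longrightarrow> sg i e \<otimes> x a i e = x a (Suc i) e \<otimes> sg i (\<not> e)"
  by (simp add: X_Suc m_assoc)

lemma sg_X_down: "1 \<le> i \<Longrightarrow> sg i (\<not> e) \<otimes> x a (Suc i) e = x a i e \<otimes> sg i e"
  by (simp add: X_Suc)

lemma s_lp_above: "i < k \<Longrightarrow> 1 \<le> i \<Longrightarrow> lp a i \<otimes> s k = s k \<otimes> lp a i"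
proof (induction i)
  case (Suc i)
  show ?case
  proof (cases "i = 0")
    case True
    then show ?thesis using Suc.prems by (simp add: t_s)
  next
    case False
    then have "lp a i \<otimes> s k = s k \<otimes> lp a i" "s i \<otimes> s k = s k \<otimes> s i"
      using Suc s_far[of i k] by auto
    then show ?thesis using False by (simp add: commute_mult)
  qed
qed simp

text \<open>The essential case is i = k + 2. Coming from the right, \<sigma>_k becomes
  \<sigma>_{k+1} by the braid relation, slides past the inner looping of index k, and becomes
  \<sigma>_k again on the left.\<close>

lemma s_lp_below:
  assumes "1 \<le> k" "k + 1 < i" "i \<le> n"
  shows "lp a i \<otimes> s k = s k \<otimes> lp a i"
  using assms(2,3)
proof (induction i)
  case (Suc i)
  show ?case
  proof (cases "i = k + 1")
    case True
    let ?b = "s (Suc k)" and ?c = "s k" and ?l = "lp a k"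
    have br: "?c \<otimes> (?b \<otimes> ?c) = ?b \<otimes> (?c \<otimes> ?b)"
      using s_braid[of k] Suc.prems True assms by simp
    have lb: "?l \<otimes> ?b = ?b \<otimes> ?l"
      using s_lp_above[of k "Suc k"] assms by simp
    have "?b \<otimes> (?c \<otimes> ?l \<otimes> ?c) \<otimes> ?b \<otimes> ?c = ?b \<otimes> ?c \<otimes> ?l \<otimes> (?c \<otimes> (?b \<otimes> ?c))"
      by (simp add: m_assoc)
    also have "\<dots> = ?b \<otimes> ?c \<otimes> (?l \<otimes> ?b) \<otimes> ?c \<otimes> ?b"
      unfolding br by (simp add: m_assoc)
    also have "\<dots> = (?b \<otimes> (?c \<otimes> ?b)) \<otimes> ?l \<otimes> ?c \<otimes> ?b"
      unfolding lb by (simp add: m_assoc)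
    also have "\<dots> = ?c \<otimes> (?b \<otimes> (?c \<otimes> ?l \<otimes> ?c) \<otimes> ?b)"
      unfolding br[symmetric] by (simp add: m_assoc)
    finally show ?thesis using True assms by simp
  next
    case False
    then have "lp a i \<otimes> s k = s k \<otimes> lp a i" "s i \<otimes> s k = s k \<otimes> s i"
      using Suc s_far[of k i] by auto
    then show ?thesis using Suc.prems by (simp add: commute_mult)
  qed
qed simp

lemma sg_X_commute:
  assumes "1 \<le> k" "1 \<le> i" "i \<le> n" "i < k \<or> k + 1 < i"
  shows "sg k e \<otimes> X (Looping a i f) = X (Looping a i f) \<otimes> sg k e"
  unfolding sg_def X_def
  using assms s_lp_above[of i k a] s_lp_below[of k i a] by (intro commute_pw) auto

text \<open>Raising either index adds a generator that commutes with the other looping, so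
  everything comes down to index 2 against index 1.\<close>

lemma lp_commute_step:
  assumes base: "1 < n \<Longrightarrow> lp b 2 \<otimes> t a = t a \<otimes> lp b 2"
    and "1 \<le> m" "m < i" "i \<le> n"
  shows "lp b i \<otimes> lp a m = lp a m \<otimes> lp b i"
  using assms(2-)
proof (induction m arbitrary: i)
  case (Suc m)
  show ?case
  proof (cases "m = 0")
    case True
    from Suc.prems(2,3) have "lp b i \<otimes> t a = t a \<otimes> lp b i"
    proof (induction i)
      case (Suc i)
      show ?case
      proof (cases "i = 1")
        case True
        then show ?thesis using base Suc.prems by (simp add: numeral_2_eq_2)
      next
        case False
        then have "2 \<le> i" using Suc.prems by simp
        then have "lp b i \<otimes> t a = t a \<otimes> lp b i" "s i \<otimes> t a = t a \<otimes> s i"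
          using Suc t_s[of i a] \<open>m = 0\<close> by auto
        then show ?thesis using \<open>2 \<le> i\<close> by (simp add: commute_mult)
      qed
    qed simp
    then show ?thesis using True by simp
  next
    case False
    then have "lp a m \<otimes> lp b i = lp b i \<otimes> lp a m" "s m \<otimes> lp b i = lp b i \<otimes> s m"
      using Suc.IH[of i] Suc.prems s_lp_below[of m i b] by auto
    then show ?thesis using False by (simp add: commute_mult)
  qed
qed simp

text \<open>The base case is a defining relation: \<open>t_t\<close> for equal strands,
  \<open>Tau_TT\<close> for T_2 against \<tau>_1. There is none for \<tau>_2 against T_1, which is
  the excluded pair.\<close>

lemma X_commute:
  assumes "1 \<le> m" "m < i" "i \<le> n" "b = TT \<or> a = Tau"
  shows "x b i e \<otimes> x a m f = x a m f \<otimes> x b i e"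
proof -
  have "1 < n \<Longrightarrow> lp b 2 \<otimes> t a = t a \<otimes> lp b 2"
    using assms(4) t_t[of a] Tau_TT by (cases a; cases b) (auto simp: numeral_2_eq_2 m_assoc)
  then show ?thesis
    unfolding X_def using assms lp_commute_step by (intro commute_pw) auto
qed

text \<open>Multiply the commutation of T_{m+1}^f and \<tau>_m^e by \<sigma>_m^-f on both sides. The
  braiding signs are tied to the sign of T_m, whereas the sign of \<tau>_m is free.\<close>

lemma mixed_flip:
  assumes "1 \<le> m" "m < n"
  shows "sg m (\<not> f) \<otimes> (x Tau m e \<otimes> (sg m f \<otimes> x TT m f)) =
    x TT m f \<otimes> (sg m f \<otimes> (x Tau m e \<otimes> sg m (\<not> f)))"
proof -
  have "x TT (Suc m) f \<otimes> x Tau m e = x Tau m e \<otimes> x TT (Suc m) f"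
    using assms by (intro X_commute) auto
  then have "sg m (\<not> f) \<otimes> (x Tau m e \<otimes> x TT (Suc m) f) \<otimes> sg m (\<not> f) =
      sg m (\<not> f) \<otimes> (x TT (Suc m) f \<otimes> x Tau m e) \<otimes> sg m (\<not> f)"
    by simp
  then show ?thesis
    using assms by (simp add: X_Suc m_assoc)
qed

text \<open>Regrouping \<sigma>_m T_m \<sigma>_m T_m \<sigma>_m exchanges the two loopings while
  \<sigma>_m passes to the right, and the loopings commute.\<close>

lemma sg_commute_square:
  assumes "1 \<le> m" "m < n"
  shows "sg m f \<otimes> (x a m f \<otimes> x a (Suc m) f) = x a m f \<otimes> (x a (Suc m) f \<otimes> sg m f)"
proof -
  have c: "x a (Suc m) f \<otimes> x a m f = x a m f \<otimes> x a (Suc m) f"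
    using assms by (cases a) (auto intro!: X_commute)
  have "sg m f \<otimes> (x a m f \<otimes> x a (Suc m) f) = (x a (Suc m) f \<otimes> x a m f) \<otimes> sg m f"
    using assms by (simp add: X_Suc m_assoc)
  then show ?thesis unfolding c by (simp add: m_assoc)
qed

end

section \<open>Sorting loopings modulo the quadratic relation\<close>

text \<open>Abstractly, \<open>red b S\<close> says that the image of \<open>b\<close> in the Hecke algebra is a linear combination
  of images of elements of \<open>S\<close>.\<close>

locale mixed_reduction = mixed_braid_elems +
  fixes red :: "'a \<Rightarrow> 'a set \<Rightarrow> bool"
  assumes red_base: "b \<in> S \<Longrightarrow> b \<in> carrier G \<Longrightarrow> red b S"
    and red_ctxt: "red b S \<Longrightarrow> c \<in> carrier G \<Longrightarrow> d \<in> carrier G \<Longrightarrow>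
      (\<And>b'. b' \<in> S \<Longrightarrow> b' \<in> carrier G \<Longrightarrow> red (c \<otimes> b' \<otimes> d) S') \<Longrightarrow> red (c \<otimes> b \<otimes> d) S'"
    and red_closed: "red b S \<Longrightarrow> b \<in> carrier G"
    and red_sg: "red (sg k e) {sg k (\<not> e), \<one>}"
begin

lemma red_left:
  assumes "red b S" "c \<in> carrier G"
    and "\<And>b'. b' \<in> S \<Longrightarrow> b' \<in> carrier G \<Longrightarrow> red (c \<otimes> b') S'"
  shows "red (c \<otimes> b) S'"
  using red_ctxt[of b S c \<one> S'] assms red_closed[OF assms(1)] by simp

lemma red_right:
  assumes "red b S" "d \<in> carrier G"
    and "\<And>b'. b' \<in> S \<Longrightarrow> b' \<in> carrier G \<Longrightarrow> red (b' \<otimes> d) S'"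
  shows "red (b \<otimes> d) S'"
  using red_ctxt[of b S \<one> d S'] assms red_closed[OF assms(1)] by simp

lemma red_trans:
  assumes "red b S" "\<And>b'. b' \<in> S \<Longrightarrow> b' \<in> carrier G \<Longrightarrow> red b' S'"
  shows "red b S'"
  using red_left[of b S \<one> S'] assms red_closed[OF assms(1)] by simp

lemma red_mono: "red b S \<Longrightarrow> S \<subseteq> S' \<Longrightarrow> red b S'"
  by (erule red_trans) (auto intro: red_base)

text \<open>The working form of the quadratic relation: the sign of a braiding letter may be changed
  at the price of the word with that letter deleted.\<close>

lemma red_sg_ctxt:
  assumes "c \<in> carrier G" "d \<in> carrier G"
    and "red (c \<otimes> (sg k (\<not> e) \<otimes> d)) S" "red (c \<otimes> d) S"
  shows "red (c \<otimes> (sg k e \<otimes> d)) S"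
proof -
  have "red (c \<otimes> sg k e \<otimes> d) S"
    by (rule red_ctxt[OF red_sg[of k e]]) (use assms in \<open>auto simp: m_assoc\<close>)
  then show ?thesis using assms by (simp add: m_assoc)
qed

lemma red_sg_left:
  assumes "d \<in> carrier G" "red (sg k (\<not> e) \<otimes> d) S" "red d S"
  shows "red (sg k e \<otimes> d) S"
  using red_sg_ctxt[of \<one> d] assms by simp

section \<open>Words of loopings followed by braiding generators\<close>

definition HH :: "nat \<Rightarrow> nat \<Rightarrow> 'a set" where
  "HH m M = generate G (s ` {m..<M})"

definition lword :: "looping list \<Rightarrow> 'a" where
  "lword ls = list_prod G (map X ls)"

text \<open>The number \<open>N\<close> is exact, because reductions have to preserve the number of
  loopings.\<close>

definition V :: "nat \<Rightarrow> nat \<Rightarrow> nat \<Rightarrow> 'a set" where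
  "V N m M = {lword ls \<otimes> h | ls h. length ls = N \<and> index ` set ls \<subseteq> {m..M} \<and> h \<in> HH m M}"

lemma lword_simps [simp]: "lword [] = \<one>" "lword (l # ls) = X l \<otimes> lword ls"
  by (simp_all add: lword_def list_prod_def)

lemma lword_closed [simp, intro]: "lword ls \<in> carrier G"
  by (induction ls) auto

lemma HH_closed [simp]: "h \<in> HH m M \<Longrightarrow> h \<in> carrier G"
  unfolding HH_def by (rule generate_in_carrier) auto

lemma HH_one [simp, intro]: "\<one> \<in> HH m M"
  unfolding HH_def by (rule generate.one)

lemma HH_mult [intro]: "h \<in> HH m M \<Longrightarrow> h' \<in> HH m M \<Longrightarrow> h \<otimes> h' \<in> HH m M"
  unfolding HH_def by (rule generate.eng)

lemma HH_sg [intro]: "m \<le> k \<Longrightarrow> k < M \<Longrightarrow> sg k e \<in> HH m M"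
  by (auto simp: HH_def sg_def pw_def intro: generate.incl generate.inv)

lemma HH_induct [consumes 1, case_names one sg mult]:
  assumes "h \<in> HH m M" "P \<one>" "\<And>k e. m \<le> k \<Longrightarrow> k < M \<Longrightarrow> P (sg k e)"
    and "\<And>g h. g \<in> HH m M \<Longrightarrow> h \<in> HH m M \<Longrightarrow> P g \<Longrightarrow> P h \<Longrightarrow> P (g \<otimes> h)"
  shows "P h"
  using assms(1) unfolding HH_def
proof (induction rule: generate.induct)
  case (incl h)
  then obtain k where "h = s k" "m \<le> k" "k < M" by auto
  then show ?case using assms(3)[of k True] by (simp add: sg_def pw_def)
next
  case (inv h)
  then obtain k where "h = s k" "m \<le> k" "k < M" by auto
  then show ?case using assms(3)[of k False] by (simp add: sg_def pw_def)
qed (use assms in \<open>auto simp: HH_def\<close>)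

lemma HH_mono: "m' \<le> m \<Longrightarrow> HH m M \<subseteq> HH m' M"
  unfolding HH_def by (rule mono_generate) auto

lemma V_closed [simp]: "v \<in> V N m M \<Longrightarrow> v \<in> carrier G"
  by (auto simp: V_def)

lemma V_0: "V 0 m M = HH m M"
  by (force simp: V_def)

lemma V_Suc_iff:
  "v \<in> V (Suc N) m M \<longleftrightarrow> (\<exists>a i e v'. v = x a i e \<otimes> v' \<and> m \<le> i \<and> i \<le> M \<and> v' \<in> V N m M)"
proof
  assume "v \<in> V (Suc N) m M"
  then obtain ls h where v: "v = lword ls \<otimes> h" "length ls = Suc N" "index ` set ls \<subseteq> {m..M}" "h \<in> HH m M"
    unfolding V_def by auto
  then obtain l ls' where "ls = l # ls'" by (cases ls) auto
  with v show "\<exists>a i e v'. v = x a i e \<otimes> v' \<and> m \<le> i \<and> i \<le> M \<and> v' \<in> V N m M"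
    by (cases l) (fastforce simp: V_def m_assoc)
next
  assume "\<exists>a i e v'. v = x a i e \<otimes> v' \<and> m \<le> i \<and> i \<le> M \<and> v' \<in> V N m M"
  then obtain a i e ls h where
    "v = x a i e \<otimes> (lword ls \<otimes> h)" "m \<le> i" "i \<le> M"
    "length ls = N" "index ` set ls \<subseteq> {m..M}" "h \<in> HH m M"
    unfolding V_def by auto
  then show "v \<in> V (Suc N) m M"
    unfolding V_def by (intro CollectI exI[of _ "Looping a i e # ls"] exI[of _ h]) (auto simp: m_assoc)
qed

lemma V_SucI: "m \<le> i \<Longrightarrow> i \<le> M \<Longrightarrow> v \<in> V N m M \<Longrightarrow> x a i e \<otimes> v \<in> V (Suc N) m M"
  unfolding V_Suc_iff by blast

lemma V_1I: "m \<le> i \<Longrightarrow> i \<le> M \<Longrightarrow> h \<in> HH m M \<Longrightarrow> x a i e \<otimes> h \<in> V 1 m M"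
  using V_SucI[of m i M h 0] by (simp add: V_0)

lemma lword_mult_V:
  "index ` set ls \<subseteq> {m..M} \<Longrightarrow> v \<in> V N m M \<Longrightarrow> lword ls \<otimes> v \<in> V (length ls + N) m M"
proof (induction ls)
  case (Cons l ls)
  then show ?case
    using V_SucI[of m "index l" M "lword ls \<otimes> v" "length ls + N" "strand l" "positive l"]
    by (simp add: m_assoc)
qed simp

end

section \<open>Moving letters of minimal index to the front, within a fixed interval\<close>

locale mixed_reduction_interval = mixed_reduction +
  fixes m M :: nat
  assumes m_pos: "1 \<le> m" and M_le: "M \<le> n"
begin

abbreviation "HI \<equiv> HH m M"
abbreviation "VI N \<equiv> V N m M"

text \<open>If i is k or k + 1, one sign of \<sigma>_k passes through the looping exactly and
  exchanges the indices k and k + 1. The other sign is changed first, and the error term is the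
  looping alone. For all other i the two commute.\<close>

lemma red_sg_X:
  assumes k: "m \<le> k" "k < M" and i: "m \<le> i" "i \<le> M"
  shows "red (sg k e \<otimes> x a i f) (VI 1)"
proof -
  have k1: "1 \<le> k" using k m_pos by simp
  have up: "red (sg k f \<otimes> x a k f) (VI 1)" for f
    unfolding sg_X_up[OF k1] using k by (intro red_base V_1I) auto
  have down: "red (sg k (\<not> f) \<otimes> x a (Suc k) f) (VI 1)" for f
    unfolding sg_X_down[OF k1] using k by (intro red_base V_1I) auto
  have id: "red (x a i f) (VI 1)"
    using V_1I[of m i M \<one> a f] i by (intro red_base) auto
  consider "i = k" "e = f" | "i = k" "e = (\<not> f)" | "i = Suc k" "e = f" | "i = Suc k" "e = (\<not> f)"
    | "i < k \<or> k + 1 < i" by fastforce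
  then show ?thesis
  proof cases
    case 1 then show ?thesis using up by simp
  next
    case 2 then show ?thesis using up[of f] id by (simp add: red_sg_left)
  next
    case 3 then show ?thesis using down[of f] id by (simp add: red_sg_left)
  next
    case 4 then show ?thesis using down by simp
  next
    case 5
    then have "sg k e \<otimes> x a i f = x a i f \<otimes> sg k e"
      using k i m_pos M_le by (intro sg_X_commute) auto
    then show ?thesis using V_1I[of m i M "sg k e" a f] k i by (simp add: red_base HH_sg)
  qed
qed

text \<open>Braids created in the middle of a word can thus be pushed to its right end without
  changing the number of loopings.\<close>

lemma red_HH_V:
  assumes "h \<in> HI" "v \<in> VI N"
  shows "red (h \<otimes> v) (VI N)"
  using assms
proof (induction N arbitrary: h v)
  case 0
  then show ?case by (intro red_base) (auto simp: V_0)
next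
  case (Suc N)
  from Suc.prems show ?case
  proof (induction arbitrary: v rule: HH_induct)
    case one
    then show ?case by (auto intro: red_base)
  next
    case (sg k e)
    then obtain a i f v' where v: "v = x a i f \<otimes> v'" "m \<le> i" "i \<le> M" "v' \<in> VI N"
      unfolding V_Suc_iff by blast
    have "red ((sg k e \<otimes> x a i f) \<otimes> v') (VI (Suc N))"
    proof (rule red_right[OF red_sg_X])
      fix b assume "b \<in> VI 1"
      then obtain a i f h where b: "b = x a i f \<otimes> h" "m \<le> i" "i \<le> M" "h \<in> HI"
        by (auto simp: V_Suc_iff V_0)
      have "red (x a i f \<otimes> (h \<otimes> v')) (VI (Suc N))"
        using Suc.IH[OF \<open>h \<in> HI\<close> \<open>v' \<in> VI N\<close>] b
        by (rule_tac red_left) (auto intro!: red_base V_SucI)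
      then show "red (b \<otimes> v') (VI (Suc N))" using b v by (simp add: m_assoc)
    qed (use sg v in auto)
    then show ?case using v by (simp add: m_assoc)
  next
    case (mult g h)
    have "red (g \<otimes> (h \<otimes> v)) (VI (Suc N))"
      using mult by (rule_tac red_left[OF mult.IH(2)]) auto
    then show ?case using mult by (simp add: m_assoc)
  qed
qed

lemma red_V_V:
  assumes "v \<in> VI N" "v' \<in> VI N'"
  shows "red (v \<otimes> v') (VI (N + N'))"
proof -
  obtain ls h where v: "v = lword ls \<otimes> h" "length ls = N" "index ` set ls \<subseteq> {m..M}" "h \<in> HI"
    using assms unfolding V_def by auto
  have "red (lword ls \<otimes> (h \<otimes> v')) (VI (N + N'))"
    using lword_mult_V[OF v(3)] v by (rule_tac red_left[OF red_HH_V[OF v(4) assms(2)]]) (auto intro!: red_base)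
  then show ?thesis using v assms by (simp add: m_assoc)
qed

text \<open>\<open>D N\<close> collects the words of \<open>N\<close> loopings that start with a looping of minimal index, and
  \<open>Wd N\<close> below those without a looping of minimal index, both followed by braiding generators.\<close>

definition D :: "nat \<Rightarrow> 'a set" where
  "D N = {x b m f \<otimes> v | b f v N'. N = Suc N' \<and> v \<in> VI N'}"

lemma D_closed [simp]: "d \<in> D N \<Longrightarrow> d \<in> carrier G"
  by (auto simp: D_def)

lemma D_SucI: "v \<in> VI N \<Longrightarrow> x b m f \<otimes> v \<in> D (Suc N)"
  by (auto simp: D_def)

lemma red_X_D:
  assumes "red v (VI N)"
  shows "red (x b m f \<otimes> v) (D (Suc N))"
  using assms by (rule red_left) (auto intro: red_base D_SucI)

lemma red_D_mult:
  assumes "d \<in> D N" "v \<in> VI N'"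
  shows "red (d \<otimes> v) (D (N + N'))"
proof -
  obtain b f v1 N1 where d: "d = x b m f \<otimes> v1" "N = Suc N1" "v1 \<in> VI N1"
    using assms unfolding D_def by auto
  have "red (x b m f \<otimes> (v1 \<otimes> v)) (D (Suc (N1 + N')))"
    using red_V_V[OF d(3) assms(2)] by (rule red_X_D)
  then show ?thesis using d assms by (simp add: m_assoc)
qed

lemma red_D_right:
  assumes "red u (D N)" "v \<in> VI N'"
  shows "red (u \<otimes> v) (D (N + N'))"
  using assms by (rule_tac red_right[OF assms(1)]) (auto intro: red_D_mult)

text \<open>The case k = m has to be left out: \<sigma>_m can raise the leading index, as in
  \<sigma>_m T_m = T_{m+1} \<sigma>_m^-1.\<close>

lemma red_sg_D:
  assumes "d \<in> D N" "m < k" "k < M"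
  shows "red (sg k e \<otimes> d) (D N)"
proof -
  obtain b f v N' where d: "d = x b m f \<otimes> v" "N = Suc N'" "v \<in> VI N'"
    using assms unfolding D_def by auto
  have "sg k e \<otimes> x b m f = x b m f \<otimes> sg k e"
    using assms m_pos M_le by (intro sg_X_commute) auto
  then have "sg k e \<otimes> d = x b m f \<otimes> (sg k e \<otimes> v)"
    using d by (metis V_closed X_closed m_assoc sg_closed)
  moreover have "red (sg k e \<otimes> v) (VI N')"
    using assms d by (intro red_HH_V) auto
  ultimately show ?thesis using d(2) by (simp add: red_X_D)
qed

lemma red_nonbad:
  assumes "m < i" "i \<le> M" and nonbad: "a = Tau \<Longrightarrow> b = TT \<Longrightarrow> e = f"
  shows "red (x a i e \<otimes> x b m f) (D 2)"
proof (cases "a = TT \<or> b = Tau")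
  case True
  have "x a i e \<otimes> x b m f = x b m f \<otimes> (x a i e \<otimes> \<one>)"
    using X_commute[of m i a b e f] assms True m_pos M_le by auto
  moreover have "x a i e \<otimes> \<one> \<in> VI 1"
    using assms by (intro V_1I) auto
  ultimately show ?thesis using D_SucI[of "x a i e \<otimes> \<one>" 1 b f]
    by (auto intro!: red_base simp: numeral_2_eq_2)
next
  case False
  then have ab: "a = Tau" "b = TT" "e = f"
    using nonbad by (cases a; cases b; auto)+
  let ?y = "\<lambda>i. x Tau i f" and ?X = "x TT m f"
  have "red (?y i \<otimes> ?X) (D 2)"
    using assms(1,2)
  proof (induction i)
    case (Suc i)
    show ?case
    proof (cases "i = m")
      case True
      have Mn: "1 \<le> m" "m < n" using Suc.prems True m_pos M_le by auto
      let ?p = "sg m f" and ?q = "sg m (\<not> f)"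
      \<comment> \<open>This is \<tau>_{m+1}^f T_m^f written out. Only the leftmost letter changes
        its sign.\<close>
      have "red (?p \<otimes> (?y m \<otimes> (?p \<otimes> ?X))) (D 2)"
      proof (rule red_sg_left)
        have "red (?p \<otimes> (?y m \<otimes> ?q)) (VI 1)"
          using red_HH_V[of ?p "?y m \<otimes> ?q" 1] Suc.prems True
          by (metis HH_sg V_1I le_refl less_Suc_eq_le order_less_imp_le Suc_le_eq)
        then show "red (?q \<otimes> (?y m \<otimes> (?p \<otimes> ?X))) (D 2)"
          unfolding mixed_flip[OF Mn] numeral_2_eq_2 One_nat_def by (rule red_X_D)
        have "?y m \<otimes> (?p \<otimes> ?X) = ?y m \<otimes> (x TT (Suc m) f \<otimes> ?q)"
          using Mn by (simp add: sg_X_up)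
        moreover have "x TT (Suc m) f \<otimes> ?q \<in> VI 1"
          using Suc.prems True by (intro V_1I) auto
        ultimately show "red (?y m \<otimes> (?p \<otimes> ?X)) (D 2)"
          using D_SucI[of "x TT (Suc m) f \<otimes> ?q" 1 Tau f] by (auto intro!: red_base simp: numeral_2_eq_2)
      qed auto
      then show ?thesis using True Mn by (simp add: X_Suc m_assoc)
    next
      case False
      then have i: "m < i" "i < M" using Suc.prems by auto
      \<comment> \<open>So \<tau>_{i+1}^f T_m^f is \<tau>_i^f T_m^f between two copies of
        \<sigma>_i^f. As i > m, the left copy does not destroy the leading letter of index
        m.\<close>
      have c: "sg i f \<otimes> ?X = ?X \<otimes> sg i f"
        using i m_pos M_le by (intro sg_X_commute) auto
      have "?y (Suc i) \<otimes> ?X = sg i f \<otimes> (?y i \<otimes> ?X) \<otimes> sg i f"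
        using i m_pos by (simp add: X_Suc m_assoc c)
      moreover have "red (sg i f \<otimes> (?y i \<otimes> ?X) \<otimes> sg i f) (D 2)"
      proof (rule red_ctxt)
        show "red (?y i \<otimes> ?X) (D 2)" using Suc.IH i by auto
        fix d assume "d \<in> D 2"
        then have "red (sg i f \<otimes> d) (D 2)" using i by (intro red_sg_D) auto
        then show "red (sg i f \<otimes> d \<otimes> sg i f) (D 2)"
          using red_D_right[of "sg i f \<otimes> d" 2 "sg i f" 0] HH_sg[of m i M f] i by (simp add: V_0)
      qed auto
      ultimately show ?thesis by simp
    qed
  qed simp
  then show ?thesis using ab by simp
qed

text \<open>The pairs not covered by \<open>red_nonbad\<close>, \<open>\<tau>\<^sub>i\<close> and \<open>T\<^sub>m\<close> with opposite signs, are treated by inserting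
  a braid \<open>A\<close>: it is \<open>\<sigma>\<^sub>m\<^sup>2\<close> or its inverse for \<open>i = m + 1\<close>, and conjugated by \<open>\<sigma>\<^sub>i\<close> when passing
  from \<open>i\<close> to \<open>i + 1\<close>.\<close>

lemma bad_conjugator:
  assumes "m < i" "i \<le> M"
  shows "\<exists>A u. A \<in> HI \<and> u \<in> HI \<and>
    red (x Tau i (\<not> f) \<otimes> (A \<otimes> x TT m f)) (D 2) \<and>
    red (x TT m f) ({A \<otimes> (x TT m f \<otimes> h) | h. h \<in> HI} \<union> {x TT i f \<otimes> h | h. h \<in> HI}) \<and>
    x TT m f \<otimes> x TT i f = A \<otimes> (x TT m f \<otimes> (x TT i f \<otimes> u))"
  using assms
proof (induction i)
  case (Suc i)
  let ?X = "\<lambda>i. x TT i f" and ?y = "\<lambda>i. x Tau i (\<not> f)"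
  let ?p = "sg i f" and ?q = "sg i (\<not> f)"
  have i: "1 \<le> i" "i < n" "i < M" "m \<le> i" using Suc.prems m_pos M_le by auto
  have pq: "?p \<in> HI" "?q \<in> HI" using i by auto
  show ?case
  proof (cases "i = m")
    case True
    \<comment> \<open>The looping \<tau>_{m+1}^-f ends with \<sigma>_m^-f, while
      \<open>mixed_flip\<close> needs \<sigma>_m^f in front of T_m^f; the square makes up the
      difference.\<close>
    let ?A = "?p \<otimes> ?p"
    have "?y (Suc i) \<otimes> (?A \<otimes> ?X m) = ?q \<otimes> (?y m \<otimes> (?p \<otimes> ?X m))"
      using X_Suc[of i Tau "\<not> f"] i True by (simp add: m_assoc)
    also have "\<dots> = ?X m \<otimes> (?p \<otimes> (?y m \<otimes> ?q))"
      using mixed_flip[of m f "\<not> f"] i True by simp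
    finally have e1: "?y (Suc i) \<otimes> (?A \<otimes> ?X m) = ?X m \<otimes> (?p \<otimes> (?y m \<otimes> ?q))" .
    have "red (?p \<otimes> (?y m \<otimes> ?q)) (VI 1)"
      using i pq by (intro red_HH_V V_1I) auto
    then have 1: "red (?y (Suc i) \<otimes> (?A \<otimes> ?X m)) (D 2)"
      unfolding e1 numeral_2_eq_2 One_nat_def by (rule red_X_D)
    \<comment> \<open>The word is T_m^f with a trivial product inserted. Changing the sign of
      \<open>?q\<close> gives \<open>?A\<close> in front of T_m^f, and deleting \<open>?q\<close>
      gives T_{m+1}^f followed by a braid.\<close>
    have "red (?p \<otimes> (?q \<otimes> ?X m)) ({?A \<otimes> (?X m \<otimes> h) | h. h \<in> HI} \<union> {?X (Suc i) \<otimes> h | h. h \<in> HI})"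
    proof (rule red_sg_ctxt)
      have "?A \<otimes> (?X m \<otimes> \<one>) \<in> {?A \<otimes> (?X m \<otimes> h) | h. h \<in> HI}" by blast
      then show "red (?p \<otimes> (sg i (\<not> \<not> f) \<otimes> ?X m)) ({?A \<otimes> (?X m \<otimes> h) | h. h \<in> HI} \<union> {?X (Suc i) \<otimes> h | h. h \<in> HI})"
        by (intro red_base) (auto simp: m_assoc)
      have "?p \<otimes> ?X m = ?X (Suc i) \<otimes> ?q" using sg_X_up[of i f TT] i True by simp
      then show "red (?p \<otimes> ?X m) ({?A \<otimes> (?X m \<otimes> h) | h. h \<in> HI} \<union> {?X (Suc i) \<otimes> h | h. h \<in> HI})"
        using pq by (intro red_base) auto
    qed auto
    then have 2: "red (?X m) ({?A \<otimes> (?X m \<otimes> h) | h. h \<in> HI} \<union> {?X (Suc i) \<otimes> h | h. h \<in> HI})"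
      by simp
    have c: "?p \<otimes> (?X m \<otimes> (?X (Suc i) \<otimes> z)) = ?X m \<otimes> (?X (Suc i) \<otimes> (?p \<otimes> z))" if "z \<in> carrier G" for z
    proof -
      have "?p \<otimes> (?X m \<otimes> ?X (Suc i)) \<otimes> z = ?X m \<otimes> (?X (Suc i) \<otimes> ?p) \<otimes> z"
        using sg_commute_square[of i f TT] i True by simp
      then show ?thesis using that by (simp add: m_assoc)
    qed
    \<comment> \<open>Since \<sigma>_m commutes with the product of the two loopings, the witness
      for \<open>u\<close> is the inverse of \<open>?A\<close>.\<close>
    have "?X m \<otimes> ?X (Suc i) = ?A \<otimes> (?X m \<otimes> (?X (Suc i) \<otimes> (?q \<otimes> ?q)))"
      by (simp add: m_assoc c)
    with 1 2 pq show ?thesis by blast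
  next
    case False
    then have mi: "m < i" using i by simp
    obtain A u where A: "A \<in> HI" "u \<in> HI" "red (?y i \<otimes> (A \<otimes> ?X m)) (D 2)"
      "red (?X m) ({A \<otimes> (?X m \<otimes> h) | h. h \<in> HI} \<union> {?X i \<otimes> h | h. h \<in> HI})"
      "?X m \<otimes> ?X i = A \<otimes> (?X m \<otimes> (?X i \<otimes> u))"
      using Suc.IH mi i by auto
    let ?A = "?p \<otimes> (A \<otimes> ?q)"
    have cp: "sg i e \<otimes> ?X m = ?X m \<otimes> sg i e" for e
      using i mi m_pos by (intro sg_X_commute) auto
    have cp': "sg i e \<otimes> (?X m \<otimes> z) = ?X m \<otimes> (sg i e \<otimes> z)" if "z \<in> carrier G" for e z
      using that cp[of e] by (metis X_closed m_assoc sg_closed)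
    \<comment> \<open>The last letter of \<tau>_{i+1}^-f cancels the first letter of
      \<open>?A\<close>, and the last letter of \<open>?A\<close> passes T_m^f.\<close>
    have "?y (Suc i) \<otimes> (?A \<otimes> ?X m) = ?q \<otimes> (?y i \<otimes> (A \<otimes> ?X m)) \<otimes> ?q"
      using X_Suc[of i Tau "\<not> f"] i A(1,2) by (simp add: m_assoc cp)
    moreover have "red (?q \<otimes> (?y i \<otimes> (A \<otimes> ?X m)) \<otimes> ?q) (D 2)"
    proof (rule red_ctxt[OF A(3)])
      fix d assume "d \<in> D 2"
      then have "red (?q \<otimes> d) (D 2)" using i mi by (intro red_sg_D) auto
      then show "red (?q \<otimes> d \<otimes> ?q) (D 2)"
        using red_D_right[of "?q \<otimes> d" 2 "?q" 0] pq by (auto simp: V_0)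
    qed auto
    ultimately have 1: "red (?y (Suc i) \<otimes> (?A \<otimes> ?X m)) (D 2)" by simp
    let ?S = "{?A \<otimes> (?X m \<otimes> h) | h. h \<in> HI} \<union> {?X (Suc i) \<otimes> h | h. h \<in> HI}"
    \<comment> \<open>Conjugation by \<sigma>_i^f fixes T_m^f, so the splitting for i can be
      conjugated term by term: A turns into \<open>?A\<close>, and T_i^f into T_{i+1}^f up to a
      braid on the right.\<close>
    have "red (?p \<otimes> ?X m \<otimes> ?q) ?S"
    proof (rule red_ctxt[OF A(4)])
      fix b assume "b \<in> {A \<otimes> (?X m \<otimes> h) | h. h \<in> HI} \<union> {?X i \<otimes> h | h. h \<in> HI}"
      then consider h where "h \<in> HI" "b = A \<otimes> (?X m \<otimes> h)" | h where "h \<in> HI" "b = ?X i \<otimes> h" by auto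
      then show "red (?p \<otimes> b \<otimes> ?q) ?S"
      proof cases
        case 1
        have "?p \<otimes> b \<otimes> ?q = ?A \<otimes> (?X m \<otimes> (?p \<otimes> (h \<otimes> ?q)))"
          using 1 A(1,2) by (simp add: m_assoc cp')
        then show ?thesis using 1 A(1,2) pq by (intro red_base) auto
      next
        case 2
        have "?p \<otimes> b \<otimes> ?q = (?p \<otimes> ?X i) \<otimes> (h \<otimes> ?q)"
          using 2 by (simp add: m_assoc)
        also have "\<dots> = ?X (Suc i) \<otimes> (?q \<otimes> (h \<otimes> ?q))"
          using 2 i by (simp add: sg_X_up m_assoc)
        finally show ?thesis using 2 A(1,2) pq by (intro red_base) auto
      qed
    qed auto
    then have 2: "red (?X m) ?S" by (simp add: cp m_assoc)
    have "?X m \<otimes> ?X (Suc i) = ?p \<otimes> (?X m \<otimes> ?X i) \<otimes> ?p"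
      using i by (simp add: X_Suc m_assoc cp')
    also have "?p \<otimes> (?X m \<otimes> ?X i) \<otimes> ?p = ?p \<otimes> (A \<otimes> (?X m \<otimes> (?X i \<otimes> u))) \<otimes> ?p"
      unfolding A(5) ..
    also have "\<dots> = ?A \<otimes> (?X m \<otimes> (?X (Suc i) \<otimes> (?q \<otimes> (u \<otimes> ?p))))"
      using i A(1,2) by (simp add: X_Suc m_assoc cp')
    finally have "?X m \<otimes> ?X (Suc i) = ?A \<otimes> (?X m \<otimes> (?X (Suc i) \<otimes> (?q \<otimes> (u \<otimes> ?p))))" .
    moreover have "?A \<in> HI" "?q \<otimes> (u \<otimes> ?p) \<in> HI"
      using A(1,2) pq by auto
    ultimately show ?thesis
      using 1 2 by blast
  qed
qed simp


definition Wd :: "nat \<Rightarrow> 'a set" where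
  "Wd N = {lword ls \<otimes> h | ls h. length ls = N \<and> index ` set ls \<subseteq> {Suc m..M} \<and> h \<in> HI}"

lemma Wd_SucI:
  assumes "w \<in> Wd N" "m < i" "i \<le> M"
  shows "x a i e \<otimes> w \<in> Wd (Suc N)"
proof -
  obtain ls h where "w = lword ls \<otimes> h" "length ls = N" "index ` set ls \<subseteq> {Suc m..M}" "h \<in> HI"
    using assms unfolding Wd_def by auto
  then show ?thesis using assms unfolding Wd_def
    by (intro CollectI exI[of _ "Looping a i e # ls"] exI[of _ h]) (auto simp: m_assoc)
qed

lemma red_nonbad_mult:
  assumes "m < i" "i \<le> M" "a = Tau \<Longrightarrow> b = TT \<Longrightarrow> e = f" "v \<in> VI N"
  shows "red (x a i e \<otimes> (x b m f \<otimes> v)) (D (Suc (Suc N)))"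
proof -
  have "red (x a i e \<otimes> x b m f \<otimes> v) (D (2 + N))"
    using assms by (intro red_D_right red_nonbad)
  then show ?thesis using assms by (simp add: m_assoc)
qed

text \<open>The pair cannot be treated without its context, hence the assumption on tails of length
  \<open>N\<close>, two less than the whole word. The strong induction in
  \<open>red_min_first\<close> supplies it.\<close>

lemma red_bad_mult:
  assumes IH: "\<And>v. v \<in> VI N \<Longrightarrow> red v (D N \<union> Wd N)"
    and i: "m < i" "i \<le> M" and v: "v \<in> VI N"
  shows "red (x Tau i (\<not> f) \<otimes> (x TT m f \<otimes> v)) (D (Suc (Suc N)) \<union> Wd (Suc (Suc N)))"
    (is "red _ ?S")
proof -
  let ?y = "x Tau i (\<not> f)" and ?X = "\<lambda>i. x TT i f"
  obtain A u where A: "A \<in> HI" "u \<in> HI" and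
    flip: "red (?y \<otimes> (A \<otimes> ?X m)) (D 2)" and
    split: "red (?X m) ({A \<otimes> (?X m \<otimes> h) | h. h \<in> HI} \<union> {?X i \<otimes> h | h. h \<in> HI})" and
    square: "?X m \<otimes> ?X i = A \<otimes> (?X m \<otimes> (?X i \<otimes> u))"
    using bad_conjugator[OF i, of f] by auto
  have flip': "red (?y \<otimes> (A \<otimes> ?X m) \<otimes> b) ?S" if "b \<in> VI N" for b
    using red_mono[OF red_D_right[OF flip that], of ?S] by simp
  have comm: "?X i \<otimes> x c m g = x c m g \<otimes> ?X i" for c g
    using i m_pos M_le by (intro X_commute) auto
  \<comment> \<open>\<open>?y \<otimes> ?X i\<close> cannot be sorted by itself; if the rest of the word starts with a letter of index \<open>m\<close>,
    then this letter moves to the front: by \<open>square\<close> if it is \<open>?X m\<close>, and because it then forms a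
    good pair with \<open>?y\<close> otherwise.\<close>
  have pair: "red (?y \<otimes> ?X i \<otimes> b) ?S" if b: "b \<in> VI N" for b
  proof (rule red_left[OF IH[OF b]])
    fix b' assume "b' \<in> D N \<union> Wd N" and b': "b' \<in> carrier G"
    then consider "b' \<in> Wd N" | "b' \<in> D N" by auto
    then show "red (?y \<otimes> ?X i \<otimes> b') ?S"
    proof cases
      case 1
      then have "?y \<otimes> (?X i \<otimes> b') \<in> Wd (Suc (Suc N))"
        using i by (intro Wd_SucI)
      then show ?thesis using b' by (intro red_base) (auto simp: m_assoc)
    next
      case 2
      then obtain c g v3 N3 where b'_eq: "b' = x c m g \<otimes> v3" "N = Suc N3" and v3: "v3 \<in> VI N3"
        unfolding D_def by auto
      show ?thesis
      proof (cases "c = TT \<and> g = f")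
        case True
        have "?y \<otimes> ?X i \<otimes> b' = ?y \<otimes> (?X i \<otimes> x c m g) \<otimes> v3"
          using b'_eq v3 by (simp add: m_assoc)
        also have "?X i \<otimes> x c m g = A \<otimes> (?X m \<otimes> (?X i \<otimes> u))"
          using comm[of c g] True square by simp
        also have "?y \<otimes> (A \<otimes> (?X m \<otimes> (?X i \<otimes> u))) \<otimes> v3 = (?y \<otimes> (A \<otimes> ?X m) \<otimes> ?X i) \<otimes> (u \<otimes> v3)"
          using A v3 by (simp add: m_assoc)
        finally have eq: "?y \<otimes> ?X i \<otimes> b' = (?y \<otimes> (A \<otimes> ?X m) \<otimes> ?X i) \<otimes> (u \<otimes> v3)" .
        show ?thesis
          unfolding eq
        proof (rule red_left[OF red_HH_V[OF A(2) v3]])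
          fix b assume "b \<in> VI N3"
          then have "red (?y \<otimes> (A \<otimes> ?X m) \<otimes> (?X i \<otimes> b)) ?S"
            using i b'_eq(2) by (intro flip') (simp add: V_SucI)
          then show "red (?y \<otimes> (A \<otimes> ?X m) \<otimes> ?X i \<otimes> b) ?S"
            using A \<open>b \<in> VI N3\<close> by (simp add: m_assoc)
        qed (use A in auto)
      next
        case False
        have "?y \<otimes> ?X i \<otimes> b' = ?y \<otimes> (?X i \<otimes> x c m g) \<otimes> v3"
          using b'_eq v3 by (simp add: m_assoc)
        also have "\<dots> = ?y \<otimes> (x c m g \<otimes> (?X i \<otimes> v3))"
          unfolding comm using v3 by (simp add: m_assoc)
        finally have eq: "?y \<otimes> ?X i \<otimes> b' = ?y \<otimes> (x c m g \<otimes> (?X i \<otimes> v3))" .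
        have "red (?y \<otimes> (x c m g \<otimes> (?X i \<otimes> v3))) (D (Suc (Suc N)))"
          using i False b'_eq(2) v3 by (intro red_nonbad_mult) (auto simp: V_SucI)
        then show ?thesis unfolding eq by (rule red_mono) auto
      qed
    qed
  qed auto
  \<comment> \<open>Both kinds of terms of \<open>split\<close> end in a braid h, which is absorbed
    by the tail before \<open>flip'\<close> or \<open>pair\<close> applies.\<close>
  have "red (?y \<otimes> ?X m \<otimes> v) ?S"
  proof (rule red_ctxt[OF split])
    fix b assume "b \<in> {A \<otimes> (?X m \<otimes> h) | h. h \<in> HI} \<union> {?X i \<otimes> h | h. h \<in> HI}"
    then consider h where "h \<in> HI" "b = A \<otimes> (?X m \<otimes> h)" | h where "h \<in> HI" "b = ?X i \<otimes> h" by auto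
    then show "red (?y \<otimes> b \<otimes> v) ?S"
    proof cases
      case 1
      have "red (?y \<otimes> (A \<otimes> ?X m) \<otimes> (h \<otimes> v)) ?S"
        using A by (rule_tac red_left[OF red_HH_V[OF 1(1) v]]) (auto intro: flip')
      then show ?thesis using 1 A(1) v by (simp add: m_assoc)
    next
      case 2
      have "red (?y \<otimes> ?X i \<otimes> (h \<otimes> v)) ?S"
        by (rule red_left[OF red_HH_V[OF 2(1) v]]) (auto intro: pair)
      then show ?thesis using 2 v by (simp add: m_assoc)
    qed
  qed (use v in auto)
  then show ?thesis using v by (simp add: m_assoc)
qed

lemma red_min_first: "v \<in> VI N \<Longrightarrow> red v (D N \<union> Wd N)"
proof (induction N arbitrary: v rule: less_induct)
  case (less N)
  show ?case
  proof (cases N)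
    case 0
    then have "v \<in> HI" using less.prems by (simp add: V_0)
    then have "v \<in> Wd N" using 0
      unfolding Wd_def by (intro CollectI exI[of _ "[]"] exI[of _ v]) auto
    then show ?thesis using less.prems by (auto intro: red_base)
  next
    case (Suc N1)
    then obtain a i e v' where v: "v = x a i e \<otimes> v'" "m \<le> i" "i \<le> M" "v' \<in> VI N1"
      using less.prems unfolding Suc V_Suc_iff by blast
    show ?thesis
    proof (cases "i = m")
      case True
      then have "v \<in> D N" using v Suc by (simp add: D_SucI)
      then show ?thesis using less.prems by (auto intro: red_base)
    next
      case False
      then have i: "m < i" "i \<le> M" using v by auto
      \<comment> \<open>With the tail normalised, at most its first letter has index m in a way that
        matters: a tail in \<open>Wd\<close> just takes one more letter, and a tail in
        \<open>D\<close> leaves one pair to sort.\<close>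
      have "red v' (D N1 \<union> Wd N1)" using less.IH[of N1] Suc v(4) by simp
      then have "red (x a i e \<otimes> v') (D N \<union> Wd N)"
      proof (rule red_left)
        fix b assume "b \<in> D N1 \<union> Wd N1" and b: "b \<in> carrier G"
        then consider "b \<in> Wd N1" | "b \<in> D N1" by auto
        then show "red (x a i e \<otimes> b) (D N \<union> Wd N)"
        proof cases
          case 1
          then have "x a i e \<otimes> b \<in> Wd N" using Wd_SucI[OF _ i] Suc by simp
          then show ?thesis using b by (auto intro: red_base)
        next
          case 2
          then obtain c g v2 N2 where b_eq: "b = x c m g \<otimes> v2" "N1 = Suc N2" and v2: "v2 \<in> VI N2"
            unfolding D_def by auto
          show ?thesis
          proof (cases "a = Tau \<and> c = TT \<and> e = (\<not> g)")
            case True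
            have "red v (D N2 \<union> Wd N2)" if "v \<in> VI N2" for v
              using less.IH[of N2] that Suc b_eq(2) by simp
            from red_bad_mult[OF this i v2, of g] show ?thesis
              using True b_eq Suc by simp
          next
            case False
            then have "red (x a i e \<otimes> (x c m g \<otimes> v2)) (D (Suc (Suc N2)))"
              using i v2 by (intro red_nonbad_mult) auto
            then show ?thesis using b_eq Suc by (auto intro: red_mono)
          qed
        qed
      qed auto
      then show ?thesis using v by simp
    qed
  qed
qed

end

section \<open>Sorted words by induction on the interval\<close>

context mixed_reduction
begin

definition Sd :: "nat \<Rightarrow> nat \<Rightarrow> nat \<Rightarrow> 'a set" where
  "Sd N m M = {lword ls \<otimes> h | ls h.
     length ls = N \<and> index ` set ls \<subseteq> {m..M} \<and> sorted (map index ls) \<and> h \<in> HH m M}"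

lemma Sd_min_ConsI:
  assumes "b \<in> Sd N m M" "m \<le> M"
  shows "x a m e \<otimes> b \<in> Sd (Suc N) m M"
proof -
  obtain ls h where "b = lword ls \<otimes> h" "length ls = N" "index ` set ls \<subseteq> {m..M}"
    "sorted (map index ls)" "h \<in> HH m M"
    using assms unfolding Sd_def by auto
  then show ?thesis using assms(2) unfolding Sd_def
    by (intro CollectI exI[of _ "Looping a m e # ls"] exI[of _ h]) (auto simp: m_assoc)
qed

theorem red_sorted:
  assumes "1 \<le> m" "m \<le> M" "M \<le> n" "v \<in> V N m M"
  shows "red v (Sd N m M)"
  using assms
proof (induction "M - m" arbitrary: m N v)
  case 0
  then have "m = M" by simp
  then obtain ls h where v: "v = lword ls \<otimes> h" "length ls = N" "index ` set ls \<subseteq> {M}" "h \<in> HH M M"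
    using 0 unfolding V_def by auto
  then have "index l = M" if "l \<in> set ls" for l
    using that by auto
  then have "sorted (map index ls)"
    by (simp add: sorted_iff_nth_mono)
  with v have "v \<in> Sd N M M" unfolding Sd_def by auto
  then show ?case using 0 \<open>m = M\<close> by (auto intro: red_base)
next
  case (Suc d)
  interpret mixed_reduction_interval G n s t red m M
    using Suc by unfold_locales auto
  have "red v (Sd N m M)" if "v \<in> V N m M" for N v
    using that
  proof (induction N arbitrary: v)
    case (0 v)
    show ?case
    proof (rule red_base)
      have "v \<in> HH m M" using 0 by (simp add: V_0)
      then show "v \<in> Sd 0 m M" unfolding Sd_def by force
    qed (use 0 in simp)
  next
    case (Suc N v)
    show ?case
    proof (rule red_trans[OF red_min_first[OF Suc.prems]])
      fix b assume "b \<in> D (Suc N) \<union> Wd (Suc N)"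
      then consider "b \<in> D (Suc N)" | "b \<in> Wd (Suc N)" by auto
      then show "red b (Sd (Suc N) m M)"
      proof cases
        case 1
        then obtain a e v' where b: "b = x a m e \<otimes> v'" "v' \<in> V N m M"
          unfolding D_def by auto
        show ?thesis
          unfolding b(1)
          by (rule red_left[OF Suc.IH[OF b(2)]])
            (auto intro!: red_base Sd_min_ConsI simp: \<open>m \<le> M\<close>)
      next
        case 2
        then obtain ls h where b: "b = lword ls \<otimes> h" "length ls = Suc N"
          "index ` set ls \<subseteq> {Suc m..M}" "h \<in> HH m M"
          unfolding Wd_def by auto
        \<comment> \<open>The tail h may contain \<sigma>_m, which the smaller interval does not
          allow. It is cut off before the outer induction hypothesis is used and put back
          afterwards.\<close>
        have "lword ls \<otimes> \<one> \<in> V (Suc N) (Suc m) M"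
          unfolding V_def using b by blast
        then have "red (lword ls) (Sd (Suc N) (Suc m) M)"
          using Suc.hyps M_le by simp
        then show ?thesis
          unfolding b(1)
        proof (rule red_right)
          fix b' assume "b' \<in> Sd (Suc N) (Suc m) M"
          then obtain ls' h' where b': "b' = lword ls' \<otimes> h'" "length ls' = Suc N"
            "index ` set ls' \<subseteq> {Suc m..M}" "sorted (map index ls')" "h' \<in> HH (Suc m) M"
            unfolding Sd_def by auto
          have "h' \<in> HH m M" using b'(5) HH_mono[of m "Suc m" M] by auto
          with b' b(4) have "b' \<otimes> h \<in> Sd (Suc N) m M"
            unfolding Sd_def
            by (intro CollectI exI[of _ ls'] exI[of _ "h' \<otimes> h"]) (auto simp: m_assoc)
          then show "red (b' \<otimes> h) (Sd (Suc N) m M)"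
            using b' b(4) by (intro red_base) auto
        qed (use b in auto)
      qed
    qed
  qed
  then show ?case using Suc by simp
qed

end
section \<open>Spans in the mixed Hecke algebra\<close>

lemma group_algebra_mult_smult:
  fixes f h :: "'g \<Rightarrow>\<^sub>0 'r::comm_ring_1"
  shows "f \<otimes>\<^bsub>group_algebra G\<^esub> (c \<odot>\<^bsub>group_algebra G\<^esub> h) = c \<odot>\<^bsub>group_algebra G\<^esub> (f \<otimes>\<^bsub>group_algebra G\<^esub> h)"
proof -
  have "f \<otimes>\<^bsub>group_algebra G\<^esub> (c \<odot>\<^bsub>group_algebra G\<^esub> h) =
    (\<Sum>a\<in>Poly_Mapping.keys f. \<Sum>b\<in>Poly_Mapping.keys h.
       Poly_Mapping.single (a \<otimes>\<^bsub>G\<^esub> b) (c * (Poly_Mapping.lookup f a * Poly_Mapping.lookup h b)))"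
    by (subst group_algebra_mult_superset[of "Poly_Mapping.keys f" _ "Poly_Mapping.keys h"])
      (simp_all add: group_algebra_def keys_map_mult mult.left_commute)
  also have "\<dots> = c \<odot>\<^bsub>group_algebra G\<^esub> (f \<otimes>\<^bsub>group_algebra G\<^esub> h)"
    by (rule poly_mapping_eqI)
      (simp add: group_algebra_def lookup_sum lookup_single sum_distrib_left mult_when)
  finally show ?thesis .
qed

text \<open>Used to cut a sorted word of loopings into the blocks \<Pi>_1, ..., \<Pi>_n; indices
  that do not occur give empty blocks.\<close>

lemma concat_filter_sorted:
  fixes f :: "'b \<Rightarrow> nat"
  assumes "sorted (map f xs)" "f ` set xs \<subseteq> {a..<b}"
  shows "concat (map (\<lambda>i. filter (\<lambda>x. f x = i) xs) [a..<b]) = xs"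
  using assms
proof (induction xs)
  case (Cons x xs)
  let ?F = "\<lambda>ys i. filter (\<lambda>x. f x = i) ys"
  have le: "f x \<le> f y" if "y \<in> set xs" for y using Cons.prems that by auto
  have range: "a \<le> f x" "f x < b" using Cons.prems by auto
  have split: "[a..<b] = [a..<f x] @ f x # [Suc (f x)..<b]"
    using range by (metis le_add_diff_inverse less_imp_le upt_add_eq_append upt_conv_Cons)
  have low: "?F ys i = []" if "i < f x" "set ys \<subseteq> insert x (set xs)" for i ys
    using that le by (force simp: filter_empty_conv)
  have low': "concat (map (?F ys) [a..<f x]) = []" if "set ys \<subseteq> insert x (set xs)" for ys
    using that low by auto
  have high: "map (?F (x # xs)) [Suc (f x)..<b] = map (?F xs) [Suc (f x)..<b]"
    by auto
  have "concat (map (?F (x # xs)) [a..<b]) =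
      x # (?F xs (f x) @ concat (map (?F xs) [Suc (f x)..<b]))"
    unfolding split map_append concat_append list.map high using low'[of "x # xs"] by auto
  also have "?F xs (f x) @ concat (map (?F xs) [Suc (f x)..<b]) = concat (map (?F xs) [a..<b])"
    unfolding split map_append concat_append list.map using low'[of xs] by auto
  also have "\<dots> = xs"
    using Cons by simp
  finally show ?case .
qed (simp add: concat_eq_Nil_conv)

lemma (in monoid) list_prod_closed:
  "set xs \<subseteq> carrier G \<Longrightarrow> list_prod G xs \<in> carrier G"
  by (induction xs) (auto simp: list_prod_def)

lemma (in monoid) list_prod_append:
  "set xs \<subseteq> carrier G \<Longrightarrow> set ys \<subseteq> carrier G \<Longrightarrow>
     list_prod G (xs @ ys) = list_prod G xs \<otimes> list_prod G ys"
proof (induction xs)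
  case Nil
  then show ?case using list_prod_closed by (simp add: list_prod_def)
next
  case (Cons x xs)
  then show ?case
    using list_prod_closed[of xs] list_prod_closed[of ys] by (simp add: list_prod_def m_assoc)
qed

lemma (in monoid) list_prod_concat:
  "(\<And>xs. xs \<in> set xss \<Longrightarrow> set xs \<subseteq> carrier G) \<Longrightarrow>
     list_prod G (concat xss) = list_prod G (map (list_prod G) xss)"
proof (induction xss)
  case (Cons xs xss)
  have "list_prod G (concat (xs # xss)) = list_prod G xs \<otimes> list_prod G (concat xss)"
    using Cons.prems by (simp add: list_prod_append UN_subset_iff)
  with Cons show ?case by (simp add: list_prod_def)
qed (simp add: list_prod_def)

lemma (in ring) eq_add_if_minus_minus_zero:
  assumes "a \<ominus> b \<ominus> c = \<zero>" "a \<in> carrier R" "b \<in> carrier R" "c \<in> carrier R"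
  shows "a = b \<oplus> c"
proof -
  have "a \<ominus> b = c" using assms by simp
  then have "a \<ominus> b \<oplus> b = b \<oplus> c" using assms by (simp add: a_comm)
  then show ?thesis using assms by (simp add: minus_eq a_assoc l_neg)
qed

section \<open>Linear combinations in the quotient algebra\<close>

context
  fixes n :: nat
begin

interpretation G: group "mixed_braid_group n"
  unfolding mixed_braid_group_def by (rule group_presented_group)
interpretation A: ring "braid_algebra n" by (rule ring_braid_algebra)
interpretation AM: Module.module class_ring "braid_algebra n" by (rule module_braid_algebra)
interpretation I: ideal "hecke_ideal n" "braid_algebra n" by (rule ideal_hecke_ideal)
interpretation H: ring "mixed_hecke n" by (rule ring_mixed_hecke)
interpretation HM: Module.module class_ring "mixed_hecke n" by (rule module_mixed_hecke)

abbreviation (input) hecke_proj :: "(mixed_braid \<Rightarrow>\<^sub>0 laurent) \<Rightarrow> hecke_elem" where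
  "hecke_proj x \<equiv> hecke_ideal n +>\<^bsub>braid_algebra n\<^esub> x"

interpretation P: ring_hom_ring "braid_algebra n" "mixed_hecke n" hecke_proj
proof (rule ring_hom_ringI2)
  show "hecke_proj \<in> Ring.ring_hom (braid_algebra n) (mixed_hecke n)"
    using I.rcos_ring_hom unfolding Ring.ring_hom_def mixed_hecke_def quotient_algebra_def by simp
qed (rule A.ring_axioms H.ring_axioms)+

lemma braid_algebra_induct [consumes 1, case_names zero single add]:
  assumes "f \<in> carrier (braid_algebra n)" "P 0"
    and "\<And>a c. a \<in> carrier (mixed_braid_group n) \<Longrightarrow> P (Poly_Mapping.single a c)"
    and "\<And>f h. P f \<Longrightarrow> P h \<Longrightarrow> P (f + h)"
  shows "P f"
  using assms unfolding braid_algebra_def by (rule group_algebra_carrier_induct)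

lemma hecke_proj_smult:
  "x \<in> carrier (braid_algebra n) \<Longrightarrow>
     hecke_proj (c \<odot>\<^bsub>braid_algebra n\<^esub> x) = c \<odot>\<^bsub>mixed_hecke n\<^esub> hecke_proj x"
  unfolding mixed_hecke_def
  by (rule quotient_algebra_smult[OF ring_braid_algebra module_braid_algebra ideal_hecke_ideal, symmetric])
    (simp_all add: braid_algebra_def group_algebra_smult_mult)

lemma hecke_carrier: "carrier (mixed_hecke n) = hecke_proj ` carrier (braid_algebra n)"
  by (auto simp: mixed_hecke_def quotient_algebra_def FactRing_def A_RCOSETS_def' a_r_coset_def')

lemma hecke_smult_mult:
  assumes "x \<in> carrier (mixed_hecke n)" "y \<in> carrier (mixed_hecke n)"
  shows "(c \<odot>\<^bsub>mixed_hecke n\<^esub> x) \<otimes>\<^bsub>mixed_hecke n\<^esub> y = c \<odot>\<^bsub>mixed_hecke n\<^esub> (x \<otimes>\<^bsub>mixed_hecke n\<^esub> y)"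
    and "x \<otimes>\<^bsub>mixed_hecke n\<^esub> (c \<odot>\<^bsub>mixed_hecke n\<^esub> y) = c \<odot>\<^bsub>mixed_hecke n\<^esub> (x \<otimes>\<^bsub>mixed_hecke n\<^esub> y)"
proof -
  obtain x' y' where x': "x' \<in> carrier (braid_algebra n)" "x = hecke_proj x'"
    and y': "y' \<in> carrier (braid_algebra n)" "y = hecke_proj y'"
    using assms unfolding hecke_carrier by auto
  have 1: "(c \<odot>\<^bsub>braid_algebra n\<^esub> x') \<otimes>\<^bsub>braid_algebra n\<^esub> y' = c \<odot>\<^bsub>braid_algebra n\<^esub> (x' \<otimes>\<^bsub>braid_algebra n\<^esub> y')"
    by (simp add: braid_algebra_def group_algebra_smult_mult)
  have 2: "x' \<otimes>\<^bsub>braid_algebra n\<^esub> (c \<odot>\<^bsub>braid_algebra n\<^esub> y') = c \<odot>\<^bsub>braid_algebra n\<^esub> (x' \<otimes>\<^bsub>braid_algebra n\<^esub> y')"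
    by (simp add: braid_algebra_def group_algebra_mult_smult)
  have c: "c \<odot>\<^bsub>braid_algebra n\<^esub> x' \<in> carrier (braid_algebra n)"
    "c \<odot>\<^bsub>braid_algebra n\<^esub> y' \<in> carrier (braid_algebra n)"
    using x' y' by auto
  show "(c \<odot>\<^bsub>mixed_hecke n\<^esub> x) \<otimes>\<^bsub>mixed_hecke n\<^esub> y = c \<odot>\<^bsub>mixed_hecke n\<^esub> (x \<otimes>\<^bsub>mixed_hecke n\<^esub> y)"
    using arg_cong[OF 1, of hecke_proj] x' y' c by (simp add: hecke_proj_smult)
  show "x \<otimes>\<^bsub>mixed_hecke n\<^esub> (c \<odot>\<^bsub>mixed_hecke n\<^esub> y) = c \<odot>\<^bsub>mixed_hecke n\<^esub> (x \<otimes>\<^bsub>mixed_hecke n\<^esub> y)"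
    using arg_cong[OF 2, of hecke_proj] x' y' c by (simp add: hecke_proj_smult)
qed

lemma hecke_image_closed [simp, intro]:
  "b \<in> carrier (mixed_braid_group n) \<Longrightarrow> hecke_image n b \<in> carrier (mixed_hecke n)"
  unfolding hecke_image_def by (intro P.hom_closed of_braid_closed)

lemma hecke_image_mult:
  assumes "a \<in> carrier (mixed_braid_group n)" "b \<in> carrier (mixed_braid_group n)"
  shows "hecke_image n (a \<otimes>\<^bsub>mixed_braid_group n\<^esub> b) = hecke_image n a \<otimes>\<^bsub>mixed_hecke n\<^esub> hecke_image n b"
proof -
  have "of_braid (a \<otimes>\<^bsub>mixed_braid_group n\<^esub> b) = of_braid a \<otimes>\<^bsub>braid_algebra n\<^esub> of_braid b"
    by (simp add: of_braid_def braid_algebra_def group_algebra_mult_single)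
  then show ?thesis
    unfolding hecke_image_def using assms P.hom_mult of_braid_closed by simp
qed

lemma hecke_image_one: "hecke_image n \<one>\<^bsub>mixed_braid_group n\<^esub> = \<one>\<^bsub>mixed_hecke n\<^esub>"
proof -
  have "of_braid \<one>\<^bsub>mixed_braid_group n\<^esub> = \<one>\<^bsub>braid_algebra n\<^esub>"
    by (simp add: of_braid_def braid_algebra_def group_algebra_def)
  then show ?thesis using P.hom_one unfolding hecke_image_def by simp
qed

lemma hecke_image_inv:
  assumes "b \<in> carrier (mixed_braid_group n)"
  shows "hecke_image n (inv\<^bsub>mixed_braid_group n\<^esub> b) = inv\<^bsub>mixed_hecke n\<^esub> hecke_image n b"
  by (rule H.inv_char[symmetric])
    (use assms in \<open>simp_all add: hecke_image_mult[symmetric] hecke_image_one\<close>)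

lemma hecke_image_list_prod:
  "set bs \<subseteq> carrier (mixed_braid_group n) \<Longrightarrow>
     hecke_image n (list_prod (mixed_braid_group n) bs) = list_prod (mixed_hecke n) (map (hecke_image n) bs)"
proof (induction bs)
  case (Cons b bs)
  have "list_prod (mixed_braid_group n) bs \<in> carrier (mixed_braid_group n)"
    using Cons.prems by (intro G.list_prod_closed) auto
  then show ?case using Cons by (simp add: list_prod_def hecke_image_mult)
qed (simp add: list_prod_def hecke_image_one)

lemma hecke_span_submodule:
  "S \<subseteq> carrier (mixed_hecke n) \<Longrightarrow> submodule class_ring (hecke_span n S) (mixed_hecke n)"
  by (rule HM.span_is_submodule)

text \<open>The elements y for which c y d lies in the span of T form a submodule; it contains S and
  hence the span of S.\<close>

lemma hecke_span_mult_ctxt: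
  assumes x: "x \<in> hecke_span n S" and S: "S \<subseteq> carrier (mixed_hecke n)"
    and T: "T \<subseteq> carrier (mixed_hecke n)"
    and c: "c \<in> carrier (mixed_hecke n)" and d: "d \<in> carrier (mixed_hecke n)"
    and ST: "\<And>y. y \<in> S \<Longrightarrow> c \<otimes>\<^bsub>mixed_hecke n\<^esub> y \<otimes>\<^bsub>mixed_hecke n\<^esub> d \<in> hecke_span n T"
  shows "c \<otimes>\<^bsub>mixed_hecke n\<^esub> x \<otimes>\<^bsub>mixed_hecke n\<^esub> d \<in> hecke_span n T"
proof -
  interpret T: submodule class_ring "hecke_span n T" "mixed_hecke n"
    using T by (rule hecke_span_submodule)
  let ?N = "{y \<in> carrier (mixed_hecke n). c \<otimes>\<^bsub>mixed_hecke n\<^esub> y \<otimes>\<^bsub>mixed_hecke n\<^esub> d \<in> hecke_span n T}"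
  have "submodule class_ring ?N (mixed_hecke n)"
  proof (unfold_locales, goal_cases)
    case 1
    then show ?case by auto
  next
    case (2 v w)
    then show ?case using c d by (simp add: H.r_distr H.l_distr)
  next
    case 3
    then show ?case using c d by simp
  next
    case (4 a v)
    then show ?case
      using c d T.smult_closed[of a] HM.smult_closed[of a v] by (simp add: hecke_smult_mult)
  qed
  then have "hecke_span n S \<subseteq> ?N"
    using S ST by (intro HM.span_is_subset) auto
  then show ?thesis using x by auto
qed

lemma hecke_span_base: "S \<subseteq> carrier (mixed_hecke n) \<Longrightarrow> x \<in> S \<Longrightarrow> x \<in> hecke_span n S"
  using HM.in_own_span by blast

lemma hecke_carrier_span:
  "carrier (mixed_hecke n) \<subseteq> hecke_span n (hecke_image n ` carrier (mixed_braid_group n))"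
proof
  let ?S = "hecke_image n ` carrier (mixed_braid_group n)"
  have S: "?S \<subseteq> carrier (mixed_hecke n)" by auto
  interpret S: submodule class_ring "hecke_span n ?S" "mixed_hecke n"
    using S by (rule hecke_span_submodule)
  fix x assume "x \<in> carrier (mixed_hecke n)"
  then obtain f where f: "f \<in> carrier (braid_algebra n)" "x = hecke_proj f"
    unfolding hecke_carrier by auto
  \<comment> \<open>Membership in the carrier is carried along because additivity of the projection
    requires it.\<close>
  have "f \<in> carrier (braid_algebra n) \<and> hecke_proj f \<in> hecke_span n ?S"
    using f(1)
  proof (induction rule: braid_algebra_induct)
    case zero
    have "(0 :: mixed_braid \<Rightarrow>\<^sub>0 laurent) = \<zero>\<^bsub>braid_algebra n\<^esub>"
      by (simp add: braid_algebra_def group_algebra_def)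
    then show ?case using P.hom_zero S.zero_closed by (metis A.zero_closed)
  next
    case (single a c)
    have "Poly_Mapping.single a c = c \<odot>\<^bsub>braid_algebra n\<^esub> of_braid a"
      by (simp add: braid_algebra_def group_algebra_def of_braid_def map_single)
    moreover have "hecke_proj (of_braid a) \<in> hecke_span n ?S"
      using single by (intro hecke_span_base[OF S]) (auto simp: hecke_image_def)
    ultimately show ?case
      using single by (simp add: hecke_proj_smult of_braid_closed)
  next
    case (add f h)
    have "f + h = f \<oplus>\<^bsub>braid_algebra n\<^esub> h"
      by (simp add: braid_algebra_def group_algebra_def)
    then show ?case using add P.hom_add by auto
  qed
  then show "x \<in> hecke_span n ?S" using f by simp
qed

lemma hecke_quadratic:
  assumes "k \<in> {1..<n}"
  defines "g \<equiv> hecke_image n (braid_gen n (Sig k))"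
  shows "g \<otimes>\<^bsub>mixed_hecke n\<^esub> g =
    (hecke_q - 1) \<odot>\<^bsub>mixed_hecke n\<^esub> g \<oplus>\<^bsub>mixed_hecke n\<^esub> hecke_q \<odot>\<^bsub>mixed_hecke n\<^esub> \<one>\<^bsub>mixed_hecke n\<^esub>"
proof -
  let ?s = "of_braid (braid_gen n (Sig k))"
  have s: "?s \<in> carrier (braid_algebra n)"
    using assms by (intro of_braid_closed braid_gen_closed) (auto simp: mixed_gens_def)
  have g: "g \<in> carrier (mixed_hecke n)" "g = hecke_proj ?s"
    using s by (auto simp: g_def hecke_image_def)
  have "quadratic_elem n k \<in> hecke_ideal n"
  proof -
    have "quadratic_elem n ` {1..<n} \<subseteq> carrier (braid_algebra n)"
    proof safe
      fix i assume "i \<in> {1..<n}"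
      then have "of_braid (braid_gen n (Sig i)) \<in> carrier (braid_algebra n)"
        by (intro of_braid_closed braid_gen_closed) (auto simp: mixed_gens_def)
      then show "quadratic_elem n i \<in> carrier (braid_algebra n)"
        unfolding quadratic_elem_def Let_def by (intro A.minus_closed A.m_closed AM.smult_closed) auto
    qed
    then show ?thesis
      unfolding hecke_ideal_def using A.genideal_self assms(1) by blast
  qed
  then have "hecke_proj (quadratic_elem n k) = hecke_ideal n"
    by (rule I.a_rcos_const)
  moreover have "\<zero>\<^bsub>mixed_hecke n\<^esub> = hecke_ideal n"
    unfolding mixed_hecke_def quotient_algebra_def FactRing_def by simp
  ultimately have zero: "hecke_proj (quadratic_elem n k) = \<zero>\<^bsub>mixed_hecke n\<^esub>"
    by argo
  then have "g \<otimes>\<^bsub>mixed_hecke n\<^esub> g \<ominus>\<^bsub>mixed_hecke n\<^esub> (hecke_q - 1) \<odot>\<^bsub>mixed_hecke n\<^esub> g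
      \<ominus>\<^bsub>mixed_hecke n\<^esub> hecke_q \<odot>\<^bsub>mixed_hecke n\<^esub> \<one>\<^bsub>mixed_hecke n\<^esub> = \<zero>\<^bsub>mixed_hecke n\<^esub>"
    using s unfolding quadratic_elem_def Let_def g(2) a_minus_def
    by (simp add: hecke_proj_smult)
  then show ?thesis
    using g by (intro H.eq_add_if_minus_minus_zero) auto
qed

text \<open>Multiplying the quadratic relation by g^-1 gives g = (q - 1) 1 + q g^-1. It can be
  solved for g^-1 because q is a unit, with inverse \<open>?p\<close>.\<close>

lemma hecke_inverse_span:
  assumes "k \<in> {1..<n}"
  defines "g \<equiv> hecke_image n (braid_gen n (Sig k))"
    and "g' \<equiv> hecke_image n (inv\<^bsub>mixed_braid_group n\<^esub> braid_gen n (Sig k))"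
  shows "g \<in> hecke_span n {g', \<one>\<^bsub>mixed_hecke n\<^esub>}" "g' \<in> hecke_span n {g, \<one>\<^bsub>mixed_hecke n\<^esub>}"
proof -
  let ?q = "hecke_q" and ?p = "Poly_Mapping.single (-1) 1 :: laurent"
  have \<sigma>: "braid_gen n (Sig k) \<in> carrier (mixed_braid_group n)"
    using assms(1) by (intro braid_gen_closed) (auto simp: mixed_gens_def)
  then have g: "g \<in> carrier (mixed_hecke n)" "g' \<in> carrier (mixed_hecke n)"
    by (auto simp: g_def g'_def)
  have inv: "g' \<otimes>\<^bsub>mixed_hecke n\<^esub> g = \<one>\<^bsub>mixed_hecke n\<^esub>"
    using \<sigma> by (simp add: g_def g'_def hecke_image_mult[symmetric] hecke_image_one)
  have pq: "?p * ?q = 1"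
    by (simp add: hecke_q_def mult_single)
  have "g = g' \<otimes>\<^bsub>mixed_hecke n\<^esub> (g \<otimes>\<^bsub>mixed_hecke n\<^esub> g)"
    using g inv by (simp add: H.m_assoc[symmetric])
  also have "\<dots> = (?q - 1) \<odot>\<^bsub>mixed_hecke n\<^esub> \<one>\<^bsub>mixed_hecke n\<^esub> \<oplus>\<^bsub>mixed_hecke n\<^esub> ?q \<odot>\<^bsub>mixed_hecke n\<^esub> g'"
    using hecke_quadratic[OF assms(1)] g inv unfolding g_def[symmetric]
    by (simp add: H.r_distr hecke_smult_mult)
  finally have eq: "g = (?q - 1) \<odot>\<^bsub>mixed_hecke n\<^esub> \<one>\<^bsub>mixed_hecke n\<^esub> \<oplus>\<^bsub>mixed_hecke n\<^esub> ?q \<odot>\<^bsub>mixed_hecke n\<^esub> g'" .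
  let ?c = "?p * (?q - 1)"
  have "?p \<odot>\<^bsub>mixed_hecke n\<^esub> g = ?p \<odot>\<^bsub>mixed_hecke n\<^esub> ((?q - 1) \<odot>\<^bsub>mixed_hecke n\<^esub> \<one>\<^bsub>mixed_hecke n\<^esub> \<oplus>\<^bsub>mixed_hecke n\<^esub> ?q \<odot>\<^bsub>mixed_hecke n\<^esub> g')"
    by (rule arg_cong[OF eq])
  also have "\<dots> = ?c \<odot>\<^bsub>mixed_hecke n\<^esub> \<one>\<^bsub>mixed_hecke n\<^esub> \<oplus>\<^bsub>mixed_hecke n\<^esub> (?p * ?q) \<odot>\<^bsub>mixed_hecke n\<^esub> g'"
    using g HM.smult_r_distr[of ?p] HM.smult_assoc1[of ?p] by simp
  also have "(?p * ?q) \<odot>\<^bsub>mixed_hecke n\<^esub> g' = g'"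
    unfolding pq using g HM.smult_one[of g'] by simp
  finally have pg: "?p \<odot>\<^bsub>mixed_hecke n\<^esub> g = ?c \<odot>\<^bsub>mixed_hecke n\<^esub> \<one>\<^bsub>mixed_hecke n\<^esub> \<oplus>\<^bsub>mixed_hecke n\<^esub> g'" .
  have "(- ?c) \<odot>\<^bsub>mixed_hecke n\<^esub> \<one>\<^bsub>mixed_hecke n\<^esub> \<oplus>\<^bsub>mixed_hecke n\<^esub> ?c \<odot>\<^bsub>mixed_hecke n\<^esub> \<one>\<^bsub>mixed_hecke n\<^esub> = \<zero>\<^bsub>mixed_hecke n\<^esub>"
    using HM.smult_l_distr[of "- ?c" ?c "\<one>\<^bsub>mixed_hecke n\<^esub>"] HM.smult_l_null[of "\<one>\<^bsub>mixed_hecke n\<^esub>"] by simp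
  then have eq': "g' = (- ?c) \<odot>\<^bsub>mixed_hecke n\<^esub> \<one>\<^bsub>mixed_hecke n\<^esub> \<oplus>\<^bsub>mixed_hecke n\<^esub> ?p \<odot>\<^bsub>mixed_hecke n\<^esub> g"
    unfolding pg using g by (subst H.a_assoc[symmetric]) (auto intro!: HM.smult_closed)
  have comb: "c \<odot>\<^bsub>mixed_hecke n\<^esub> \<one>\<^bsub>mixed_hecke n\<^esub> \<oplus>\<^bsub>mixed_hecke n\<^esub> d \<odot>\<^bsub>mixed_hecke n\<^esub> x
      \<in> hecke_span n {x, \<one>\<^bsub>mixed_hecke n\<^esub>}" if x: "x \<in> carrier (mixed_hecke n)" for c d x
  proof -
    have S: "{x, \<one>\<^bsub>mixed_hecke n\<^esub>} \<subseteq> carrier (mixed_hecke n)" using x by simp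
    interpret S: submodule class_ring "hecke_span n {x, \<one>\<^bsub>mixed_hecke n\<^esub>}" "mixed_hecke n"
      using S by (rule hecke_span_submodule)
    show ?thesis
      by (intro S.m_closed S.smult_closed hecke_span_base[OF S]) auto
  qed
  show "g \<in> hecke_span n {g', \<one>\<^bsub>mixed_hecke n\<^esub>}" by (subst eq) (rule comb[OF g(2)])
  show "g' \<in> hecke_span n {g, \<one>\<^bsub>mixed_hecke n\<^esub>}" by (subst eq') (rule comb[OF g(1)])
qed

section \<open>The mixed braid group and its Hecke algebra as a model of the abstract
  setting\<close>

definition hecke_red :: "mixed_braid \<Rightarrow> mixed_braid set \<Rightarrow> bool" where
  "hecke_red b S \<longleftrightarrow> b \<in> carrier (mixed_braid_group n) \<and>
     hecke_image n b \<in> hecke_span n (hecke_image n ` (S \<inter> carrier (mixed_braid_group n)))"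

text \<open>Out of range the generator is set to 1, so that closure and far commutation hold for all indices.\<close>

definition sgen :: "nat \<Rightarrow> mixed_braid" where
  "sgen k = (if k \<in> {1..<n} then braid_gen n (Sig k) else \<one>\<^bsub>mixed_braid_group n\<^esub>)"

definition tgen :: "fixed_loop \<Rightarrow> mixed_braid" where
  "tgen a = braid_gen n (Loop a)"

lemma mem_mixed_gens [simp]:
  "Loop a \<in> mixed_gens n" "Sig k \<in> mixed_gens n \<longleftrightarrow> k \<in> {1..<n}"
  by (auto simp: mixed_gens_def)

lemma sgen_closed: "sgen k \<in> carrier (mixed_braid_group n)"
  by (auto simp: sgen_def intro: braid_gen_closed)

lemma tgen_closed: "tgen a \<in> carrier (mixed_braid_group n)"
  by (auto simp: tgen_def intro: braid_gen_closed)

abbreviation (input) wcl :: "mixed_gen word \<Rightarrow> mixed_braid" where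
  "wcl \<equiv> word_class (mixed_gens n) (mixed_rels n)"

lemma wcl_closed: "u \<in> words (mixed_gens n) \<Longrightarrow> wcl u \<in> carrier (mixed_braid_group n)"
  by (auto simp: mixed_braid_group_def presented_group_def)

lemma wcl_append:
  "u \<in> words (mixed_gens n) \<Longrightarrow> v \<in> words (mixed_gens n) \<Longrightarrow>
     wcl u \<otimes>\<^bsub>mixed_braid_group n\<^esub> wcl v = wcl (u @ v)"
  unfolding mixed_braid_group_def by (rule presented_group_mult)

lemma wcl_rel:
  assumes "(u, v) \<in> mixed_rels n" "u \<in> words (mixed_gens n)" "v \<in> words (mixed_gens n)"
  shows "wcl u = wcl v"
  using assms by (simp add: word_class_eq_iff word_eq.rel)

lemma wcl_Nil: "wcl [] = \<one>\<^bsub>mixed_braid_group n\<^esub>"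
  by (simp add: mixed_braid_group_def presented_group_def)

lemma wcl_letter:
  assumes "y \<in> mixed_gens n"
  shows "wcl [(y, e)] = G.pw (braid_gen n y) e"
proof (cases e)
  case True
  then show ?thesis by (simp add: G.pw_def braid_gen_def)
next
  case False
  have "wcl [(y, False)] \<otimes>\<^bsub>mixed_braid_group n\<^esub> braid_gen n y = \<one>\<^bsub>mixed_braid_group n\<^esub>"
    using assms word_eq.cancel[of y "mixed_gens n" "mixed_rels n" False]
    by (simp add: braid_gen_def wcl_append wcl_Nil[symmetric] word_class_eq_iff)
  then have "inv\<^bsub>mixed_braid_group n\<^esub> braid_gen n y = wcl [(y, False)]"
    using assms by (intro G.inv_equality) (auto intro: braid_gen_closed wcl_closed)
  then show ?thesis using False by (simp add: G.pw_def)
qed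

lemma mixed_braid_elems: "mixed_braid_elems (mixed_braid_group n) n sgen tgen"
proof unfold_locales
  fix j k :: nat assume jk: "j + 1 < k"
  show "sgen k \<otimes>\<^bsub>mixed_braid_group n\<^esub> sgen j = sgen j \<otimes>\<^bsub>mixed_braid_group n\<^esub> sgen k"
  proof (cases "k \<in> {1..<n} \<and> j \<in> {1..<n}")
    case True
    then have "wcl [(Sig k, True), (Sig j, True)] = wcl [(Sig j, True), (Sig k, True)]"
      using jk by (intro wcl_rel) (auto simp: mixed_rels_def Let_def)
    then show ?thesis
      using True by (simp add: sgen_def braid_gen_def wcl_append)
  next
    case False
    then show ?thesis using sgen_closed[of k] sgen_closed[of j] by (auto simp: sgen_def)
  qed
next
  fix k :: nat assume k: "1 \<le> k" "k + 2 \<le> n"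
  have "wcl [(Sig k, True), (Sig (k+1), True), (Sig k, True)] =
      wcl [(Sig (k+1), True), (Sig k, True), (Sig (k+1), True)]"
    using k by (intro wcl_rel) (auto simp: mixed_rels_def Let_def)
  then show "sgen k \<otimes>\<^bsub>mixed_braid_group n\<^esub> (sgen (k + 1) \<otimes>\<^bsub>mixed_braid_group n\<^esub> sgen k) =
      sgen (k + 1) \<otimes>\<^bsub>mixed_braid_group n\<^esub> (sgen k \<otimes>\<^bsub>mixed_braid_group n\<^esub> sgen (k + 1))"
    using k by (simp add: sgen_def braid_gen_def wcl_append)
next
  fix k :: nat and a assume k: "2 \<le> k"
  show "tgen a \<otimes>\<^bsub>mixed_braid_group n\<^esub> sgen k = sgen k \<otimes>\<^bsub>mixed_braid_group n\<^esub> tgen a"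
  proof (cases "k < n")
    case True
    then have "wcl [(Loop a, True), (Sig k, True)] = wcl [(Sig k, True), (Loop a, True)]"
      using k by (intro wcl_rel) (auto simp: mixed_rels_def Let_def)
    then show ?thesis
      using True k by (simp add: sgen_def tgen_def braid_gen_def wcl_append)
  next
    case False
    then show ?thesis using tgen_closed[of a] by (auto simp: sgen_def)
  qed
next
  fix a assume n: "1 < n"
  have "wcl [(Loop a, True), (Sig 1, True), (Loop a, True), (Sig 1, True)] =
      wcl [(Sig 1, True), (Loop a, True), (Sig 1, True), (Loop a, True)]"
    using n by (intro wcl_rel) (auto simp: mixed_rels_def Let_def)
  then show "tgen a \<otimes>\<^bsub>mixed_braid_group n\<^esub> (sgen 1 \<otimes>\<^bsub>mixed_braid_group n\<^esub> (tgen a \<otimes>\<^bsub>mixed_braid_group n\<^esub> sgen 1)) =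
      sgen 1 \<otimes>\<^bsub>mixed_braid_group n\<^esub> (tgen a \<otimes>\<^bsub>mixed_braid_group n\<^esub> (sgen 1 \<otimes>\<^bsub>mixed_braid_group n\<^esub> tgen a))"
    using n by (simp add: sgen_def tgen_def braid_gen_def wcl_append)
next
  assume n: "1 < n"
  have "wcl [(Loop Tau, True), (Sig 1, True), (Loop TT, True), (Sig 1, True)] =
      wcl [(Sig 1, True), (Loop TT, True), (Sig 1, True), (Loop Tau, True)]"
    using n by (intro wcl_rel) (auto simp: mixed_rels_def Let_def)
  then show "tgen Tau \<otimes>\<^bsub>mixed_braid_group n\<^esub> (sgen 1 \<otimes>\<^bsub>mixed_braid_group n\<^esub> (tgen TT \<otimes>\<^bsub>mixed_braid_group n\<^esub> sgen 1)) =
      sgen 1 \<otimes>\<^bsub>mixed_braid_group n\<^esub> (tgen TT \<otimes>\<^bsub>mixed_braid_group n\<^esub> (sgen 1 \<otimes>\<^bsub>mixed_braid_group n\<^esub> tgen Tau))"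
    using n by (simp add: sgen_def tgen_def braid_gen_def wcl_append)
qed (rule sgen_closed tgen_closed)+

interpretation E: mixed_braid_elems "mixed_braid_group n" n sgen tgen
  by (rule mixed_braid_elems)

lemma mixed_reduction: "mixed_reduction (mixed_braid_group n) n sgen tgen hecke_red"
proof unfold_locales
  fix b :: mixed_braid and S assume "b \<in> S" "b \<in> carrier (mixed_braid_group n)"
  then show "hecke_red b S"
    unfolding hecke_red_def by (auto intro!: hecke_span_base)
next
  fix b c d :: mixed_braid and S S'
  assume b: "hecke_red b S" and cd: "c \<in> carrier (mixed_braid_group n)" "d \<in> carrier (mixed_braid_group n)"
    and S': "\<And>b'. b' \<in> S \<Longrightarrow> b' \<in> carrier (mixed_braid_group n) \<Longrightarrow>
      hecke_red (c \<otimes>\<^bsub>mixed_braid_group n\<^esub> b' \<otimes>\<^bsub>mixed_braid_group n\<^esub> d) S'"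
  have "hecke_image n c \<otimes>\<^bsub>mixed_hecke n\<^esub> hecke_image n b \<otimes>\<^bsub>mixed_hecke n\<^esub> hecke_image n d
      \<in> hecke_span n (hecke_image n ` (S' \<inter> carrier (mixed_braid_group n)))"
  proof (rule hecke_span_mult_ctxt)
    show "hecke_image n b \<in> hecke_span n (hecke_image n ` (S \<inter> carrier (mixed_braid_group n)))"
      using b unfolding hecke_red_def by simp
    fix y assume "y \<in> hecke_image n ` (S \<inter> carrier (mixed_braid_group n))"
    then obtain b' where "y = hecke_image n b'" "b' \<in> S" "b' \<in> carrier (mixed_braid_group n)" by auto
    then show "hecke_image n c \<otimes>\<^bsub>mixed_hecke n\<^esub> y \<otimes>\<^bsub>mixed_hecke n\<^esub> hecke_image n d
      \<in> hecke_span n (hecke_image n ` (S' \<inter> carrier (mixed_braid_group n)))"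
      using S'[of b'] cd unfolding hecke_red_def by (simp add: hecke_image_mult)
  qed (use cd in auto)
  then show "hecke_red (c \<otimes>\<^bsub>mixed_braid_group n\<^esub> b \<otimes>\<^bsub>mixed_braid_group n\<^esub> d) S'"
    using b cd unfolding hecke_red_def by (simp add: hecke_image_mult)
next
  fix b :: mixed_braid and S assume "hecke_red b S"
  then show "b \<in> carrier (mixed_braid_group n)" unfolding hecke_red_def by simp
next
  fix k e
  show "hecke_red (E.sg k e) {E.sg k (\<not> e), \<one>\<^bsub>mixed_braid_group n\<^esub>}"
  proof (cases "k \<in> {1..<n}")
    case True
    have "{E.sg k (\<not> e), \<one>\<^bsub>mixed_braid_group n\<^esub>} \<inter> carrier (mixed_braid_group n) =
        {E.sg k (\<not> e), \<one>\<^bsub>mixed_braid_group n\<^esub>}" by auto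
    then show ?thesis
      using hecke_inverse_span[OF True] True E.sg_closed[of k e]
      by (cases e) (simp_all add: hecke_red_def E.sg_def G.pw_def sgen_def hecke_image_one)
  next
    case False
    then have "E.sg k e = \<one>\<^bsub>mixed_braid_group n\<^esub>" by (auto simp: E.sg_def G.pw_def sgen_def)
    then show ?thesis
      unfolding hecke_red_def by (auto intro!: hecke_span_base)
  qed
qed

interpretation R: mixed_reduction "mixed_braid_group n" n sgen tgen hecke_red
  by (rule mixed_reduction)

section \<open>Part A: translation back to products of loopings\<close>

lemma looping_elem_eq: "1 \<le> i \<Longrightarrow> i \<le> n \<Longrightarrow> looping_elem n a i = E.lp a i"
proof (induction i)
  case (Suc i)
  show ?case
  proof (cases "i = 0")
    case True
    then show ?thesis using tgen_closed[of a] by (simp add: looping_elem_def list_prod_def tgen_def[symmetric])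
  next
    case False
    let ?L = "map (\<lambda>j. braid_gen n (Sig j)) (rev [1..<i]) @ [braid_gen n (Loop a)] @
        map (\<lambda>j. braid_gen n (Sig j)) [1..<i]"
    have s: "braid_gen n (Sig i) = sgen i" using False Suc.prems by (simp add: sgen_def)
    have L: "set ?L \<subseteq> carrier (mixed_braid_group n)"
      using Suc.prems by (auto simp: mixed_gens_def intro!: braid_gen_closed)
    have "looping_elem n a (Suc i) = list_prod (mixed_braid_group n) ([sgen i] @ ?L @ [sgen i])"
      using False unfolding looping_elem_def s[symmetric] by simp
    also have "\<dots> = sgen i \<otimes>\<^bsub>mixed_braid_group n\<^esub> (list_prod (mixed_braid_group n) ?L \<otimes>\<^bsub>mixed_braid_group n\<^esub> sgen i)"
      using L sgen_closed[of i] by (subst G.list_prod_append, simp, simp, subst G.list_prod_append, simp, simp)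
        (simp add: list_prod_def)
    also have "list_prod (mixed_braid_group n) ?L = E.lp a i"
      using Suc False by (simp add: looping_elem_def)
    finally show ?thesis using False by (simp add: G.m_assoc)
  qed
qed simp

lemma looping_braid_eq: "l \<in> loopings n \<Longrightarrow> looping_braid n l = E.X l"
  by (auto simp: looping_braid_def E.X_def G.pw_def looping_elem_eq loopings_def)

lemma looping_prod_eq: "set ls \<subseteq> loopings n \<Longrightarrow> looping_prod n ls = R.lword ls"
  unfolding looping_prod_def R.lword_def using looping_braid_eq
  by (intro arg_cong[of _ _ "list_prod (mixed_braid_group n)"]) auto

lemma sg_image:
  assumes "k \<in> {1..<n}"
  shows "hecke_image n (E.sg k e) =
    (if e then braiding_gen n k else inv\<^bsub>mixed_hecke n\<^esub> braiding_gen n k)"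
  using assms hecke_image_inv[OF sgen_closed[of k]]
  by (auto simp: E.sg_def G.pw_def braiding_gen_def sgen_def)

lemma HH_image:
  assumes "1 \<le> m" "M \<le> n" "h \<in> R.HH m M"
  shows "hecke_image n h \<in> signed_braiding_prods n {m..M-1}"
  using assms(3)
proof (induction rule: R.HH_induct)
  case one
  show ?case unfolding signed_braiding_prods_def
    by (intro CollectI exI[of _ "[]"]) (simp add: list_prod_def hecke_image_one)
next
  case (sg k e)
  then have k: "k \<in> {1..<n}" using assms by auto
  then have "hecke_image n (E.sg k e) \<in> carrier (mixed_hecke n)" by auto
  then show ?case unfolding signed_braiding_prods_def
    using sg sg_image[OF k, of e] by (intro CollectI exI[of _ "[(k, e)]"]) (auto simp: list_prod_def)
next
  case (mult g h)
  let ?f = "\<lambda>(j, e). if e then braiding_gen n j else inv\<^bsub>mixed_hecke n\<^esub> braiding_gen n j"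
  obtain js js' where js: "hecke_image n g = list_prod (mixed_hecke n) (map ?f js)" "fst ` set js \<subseteq> {m..M-1}"
      "hecke_image n h = list_prod (mixed_hecke n) (map ?f js')" "fst ` set js' \<subseteq> {m..M-1}"
    using mult.IH unfolding signed_braiding_prods_def by auto
  have closed: "set (map ?f js) \<subseteq> carrier (mixed_hecke n)" if "fst ` set js \<subseteq> {m..M-1}" for js
  proof -
    have "?f (k, e) \<in> carrier (mixed_hecke n)" if "(k, e) \<in> set js" for k e
    proof -
      have "k \<in> {m..M-1}" using that \<open>fst ` set js \<subseteq> {m..M-1}\<close> by force
      then have k: "k \<in> {1..<n}" using assms by auto
      have "hecke_image n (E.sg k e) \<in> carrier (mixed_hecke n)" by (rule hecke_image_closed) (rule E.sg_closed)
      then show ?thesis unfolding sg_image[OF k] by simp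
    qed
    then show ?thesis by fastforce
  qed
  have "hecke_image n (g \<otimes>\<^bsub>mixed_braid_group n\<^esub> h) = list_prod (mixed_hecke n) (map ?f (js @ js'))"
    using mult.hyps js closed by (simp add: hecke_image_mult H.list_prod_append)
  then show ?case unfolding signed_braiding_prods_def
    using js by (intro CollectI exI[of _ "js @ js'"]) (auto simp: image_Un)
qed

lemma looping_prod_sorted_span:
  assumes ls: "set ls \<subseteq> loopings n" "ls \<noteq> []"
  defines "m \<equiv> Min (index ` set ls)" and "M \<equiv> Max (index ` set ls)"
  shows "hecke_image n (looping_prod n ls) \<in> hecke_span n
    {hecke_image n w' \<otimes>\<^bsub>mixed_hecke n\<^esub> G | w' G.
      (\<exists>ls'. w' = looping_prod n ls' \<and> length ls' = length ls \<and> set ls' \<subseteq> loopings n \<and>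
        index ` set ls' \<subseteq> {m..M} \<and> sorted (map index ls')) \<and>
      (if m < M then G \<in> signed_braiding_prods n {m..M-1} else G = \<one>\<^bsub>mixed_hecke n\<^esub>)}"
    (is "_ \<in> hecke_span n ?T")
proof -
  let ?N = "length ls"
  have idx: "index ` set ls \<subseteq> {m..M}"
    by (auto simp: m_def M_def)
  have "m \<in> index ` set ls" "M \<in> index ` set ls"
    using ls(2) unfolding m_def M_def by simp_all
  then have mM: "1 \<le> m" "m \<le> M" "M \<le> n"
    using ls(1) idx by (auto simp: loopings_def)
  have "R.lword ls \<otimes>\<^bsub>mixed_braid_group n\<^esub> \<one>\<^bsub>mixed_braid_group n\<^esub> \<in> R.V ?N m M"
    unfolding R.V_def using idx by blast
  then have "hecke_red (looping_prod n ls) (R.Sd ?N m M)"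
    using R.red_sorted[OF mM] ls(1) by (simp add: looping_prod_eq)
  then have "hecke_image n (looping_prod n ls) \<in>
      hecke_span n (hecke_image n ` (R.Sd ?N m M \<inter> carrier (mixed_braid_group n)))"
    unfolding hecke_red_def by simp
  moreover have "hecke_image n ` (R.Sd ?N m M \<inter> carrier (mixed_braid_group n)) \<subseteq> ?T"
  proof
    fix x assume "x \<in> hecke_image n ` (R.Sd ?N m M \<inter> carrier (mixed_braid_group n))"
    then obtain ls' h where x: "x = hecke_image n (R.lword ls' \<otimes>\<^bsub>mixed_braid_group n\<^esub> h)"
      and ls': "length ls' = ?N" "index ` set ls' \<subseteq> {m..M}" "sorted (map index ls')"
      and h: "h \<in> R.HH m M"
      unfolding R.Sd_def by auto
    have loop: "set ls' \<subseteq> loopings n"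
      using ls'(2) mM by (force simp: loopings_def)
    then have "x = hecke_image n (looping_prod n ls') \<otimes>\<^bsub>mixed_hecke n\<^esub> hecke_image n h"
      using x h by (simp add: looping_prod_eq hecke_image_mult)
    moreover have "if m < M then hecke_image n h \<in> signed_braiding_prods n {m..M-1}
        else hecke_image n h = \<one>\<^bsub>mixed_hecke n\<^esub>"
    proof (cases "m < M")
      case True
      then show ?thesis using HH_image[OF mM(1) mM(3) h] by simp
    next
      case False
      \<comment> \<open>For m = M there are no generators, so the subgroup is trivial; this is where
        G = 1 comes from.\<close>
      then have "h = \<one>\<^bsub>mixed_braid_group n\<^esub>"
        using h by (simp add: R.HH_def G.generate_empty)
      then show ?thesis using False by (simp add: hecke_image_one)
    qed
    ultimately show "x \<in> ?T" using ls' loop by blast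
  qed
  ultimately show ?thesis
    by (rule subsetD[OF HM.span_is_monotone, rotated])
qed

section \<open>Part B: the spanning set\<close>

lemma wcl_red_V:
  assumes "n \<ge> 1" "u \<in> words (mixed_gens n)"
  shows "\<exists>N. hecke_red (word_class (mixed_gens n) (mixed_rels n) u) (R.V N 1 n)"
  using assms(2)
proof (induction u)
  case Nil
  have "\<one>\<^bsub>mixed_braid_group n\<^esub> \<in> R.V 0 1 n" by (simp add: R.V_0)
  then have "hecke_red (word_class (mixed_gens n) (mixed_rels n) []) (R.V 0 1 n)"
    unfolding wcl_Nil by (intro R.red_base) auto
  then show ?case by blast
next
  case (Cons l u)
  \<comment> \<open>On the full interval, a loop generator is a looping of index 1 and is simply
    prepended, while a braiding generator is pushed to the right end. So N counts the loop letters
    of the word.\<close>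
  interpret mixed_reduction_interval "mixed_braid_group n" n sgen tgen hecke_red 1 n
    by unfold_locales auto
  obtain y e where l: "l = (y, e)" by (cases l)
  with Cons.prems have y: "y \<in> mixed_gens n" and u: "u \<in> words (mixed_gens n)" by auto
  then obtain N where N: "hecke_red (word_class (mixed_gens n) (mixed_rels n) u) (R.V N 1 n)"
    using Cons.IH by blast
  have eq: "word_class (mixed_gens n) (mixed_rels n) (l # u) =
      G.pw (braid_gen n y) e \<otimes>\<^bsub>mixed_braid_group n\<^esub> word_class (mixed_gens n) (mixed_rels n) u"
    using wcl_append[of "[l]" u] y u l wcl_letter[of y e] by simp
  show ?case
  proof (cases y)
    case (Loop a)
    then have "G.pw (braid_gen n y) e = E.X (Looping a 1 e)"
      by (simp add: E.X_def tgen_def)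
    moreover have "hecke_red (E.X (Looping a 1 e) \<otimes>\<^bsub>mixed_braid_group n\<^esub> word_class (mixed_gens n) (mixed_rels n) u) (R.V (Suc N) 1 n)"
      using assms(1) by (intro R.red_left[OF N] R.red_base R.V_SucI) auto
    ultimately show ?thesis unfolding eq by auto
  next
    case (Sig k)
    then have k: "1 \<le> k" "k < n" using y by auto
    then have "G.pw (braid_gen n y) e = E.sg k e"
      using Sig by (simp add: E.sg_def sgen_def)
    moreover have "hecke_red (E.sg k e \<otimes>\<^bsub>mixed_braid_group n\<^esub> word_class (mixed_gens n) (mixed_rels n) u) (R.V N 1 n)"
      using k by (intro R.red_left[OF N] red_HH_V) auto
    ultimately show ?thesis unfolding eq by auto
  qed
qed

lemma braiding_gen_closed: "k \<in> {1..<n} \<Longrightarrow> braiding_gen n k \<in> carrier (mixed_hecke n)"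
  unfolding braiding_gen_def by (intro hecke_image_closed braid_gen_closed) simp

lemma braiding_prods_closed: "braiding_prods n {1..<n} \<subseteq> carrier (mixed_hecke n)"
  unfolding braiding_prods_def
  by (force intro!: H.list_prod_closed braiding_gen_closed)

lemma braiding_prods_mult:
  assumes "x \<in> braiding_prods n {1..<n}" "y \<in> braiding_prods n {1..<n}"
  shows "x \<otimes>\<^bsub>mixed_hecke n\<^esub> y \<in> braiding_prods n {1..<n}"
proof -
  obtain js js' where js: "x = list_prod (mixed_hecke n) (map (braiding_gen n) js)" "set js \<subseteq> {1..<n}"
    "y = list_prod (mixed_hecke n) (map (braiding_gen n) js')" "set js' \<subseteq> {1..<n}"
    using assms unfolding braiding_prods_def by auto
  then have "x \<otimes>\<^bsub>mixed_hecke n\<^esub> y = list_prod (mixed_hecke n) (map (braiding_gen n) (js @ js'))"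
    unfolding map_append js(1,3) using braiding_gen_closed
    by (intro H.list_prod_append[symmetric]) auto
  then show ?thesis unfolding braiding_prods_def using js by (intro CollectI exI[of _ "js @ js'"]) auto
qed

text \<open>Only positive braiding generators occur in \<open>Lambda\<close>, so each inverse is
  replaced by a combination of g_k and 1.\<close>

lemma HH_image_span:
  assumes "h \<in> R.HH 1 n"
  shows "hecke_image n h \<in> hecke_span n (braiding_prods n {1..<n})"
  using assms
proof (induction rule: R.HH_induct)
  case one
  have "\<one>\<^bsub>mixed_hecke n\<^esub> \<in> braiding_prods n {1..<n}"
    unfolding braiding_prods_def by (intro CollectI exI[of _ "[]"]) (simp add: list_prod_def)
  then show ?case unfolding hecke_image_one by (intro hecke_span_base braiding_prods_closed)
next
  case (sg k e)
  then have k: "k \<in> {1..<n}" by simp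
  have mem: "{braiding_gen n k, \<one>\<^bsub>mixed_hecke n\<^esub>} \<subseteq> braiding_prods n {1..<n}"
  proof -
    have "list_prod (mixed_hecke n) (map (braiding_gen n) [k]) \<in> braiding_prods n {1..<n}"
      unfolding braiding_prods_def using k by (intro CollectI exI[of _ "[k]"]) auto
    moreover have "list_prod (mixed_hecke n) (map (braiding_gen n) []) \<in> braiding_prods n {1..<n}"
      unfolding braiding_prods_def by (intro CollectI exI[of _ "[]"]) auto
    ultimately show ?thesis using braiding_gen_closed[OF k] by (simp add: list_prod_def)
  qed
  show ?case
  proof (cases e)
    case True
    then have "hecke_image n (E.sg k e) \<in> braiding_prods n {1..<n}"
      using sg_image[OF k, of e] mem by simp
    then show ?thesis by (rule hecke_span_base[OF braiding_prods_closed])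
  next
    case False
    then have "hecke_image n (E.sg k e) \<in> hecke_span n {braiding_gen n k, \<one>\<^bsub>mixed_hecke n\<^esub>}"
      using hecke_inverse_span(2)[OF k] k by (simp add: E.sg_def G.pw_def sgen_def braiding_gen_def)
    then show ?thesis using HM.span_is_monotone[OF mem] by blast
  qed
next
  case (mult g h)
  let ?B = "braiding_prods n {1..<n}"
  have gh: "g \<in> carrier (mixed_braid_group n)" "h \<in> carrier (mixed_braid_group n)"
    using mult.hyps by auto
  \<comment> \<open>The product of two linear combinations is expanded one factor at a time; factors
    1 fill the empty side of the two-sided context lemma.\<close>
  have "x \<otimes>\<^bsub>mixed_hecke n\<^esub> hecke_image n h \<in> hecke_span n ?B" if x: "x \<in> ?B" for x
  proof -
    have xc: "x \<in> carrier (mixed_hecke n)" using x braiding_prods_closed by auto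
    have "x \<otimes>\<^bsub>mixed_hecke n\<^esub> hecke_image n h \<otimes>\<^bsub>mixed_hecke n\<^esub> \<one>\<^bsub>mixed_hecke n\<^esub> \<in> hecke_span n ?B"
    proof (rule hecke_span_mult_ctxt[OF mult.IH(2)])
      fix y assume y: "y \<in> ?B"
      then have "y \<in> carrier (mixed_hecke n)" using braiding_prods_closed by auto
      then show "x \<otimes>\<^bsub>mixed_hecke n\<^esub> y \<otimes>\<^bsub>mixed_hecke n\<^esub> \<one>\<^bsub>mixed_hecke n\<^esub> \<in> hecke_span n ?B"
        using xc hecke_span_base[OF braiding_prods_closed braiding_prods_mult[OF x y]] by simp
    qed (use xc braiding_prods_closed in auto)
    then show ?thesis using xc gh by simp
  qed
  then have "\<one>\<^bsub>mixed_hecke n\<^esub> \<otimes>\<^bsub>mixed_hecke n\<^esub> hecke_image n g \<otimes>\<^bsub>mixed_hecke n\<^esub> hecke_image n h \<in> hecke_span n ?B"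
    using braiding_prods_closed gh
    by (intro hecke_span_mult_ctxt[OF mult.IH(1)]) (auto simp: subset_iff)
  then show ?case using gh by (simp add: hecke_image_mult)
qed

lemma looping_image_closed:
  "l \<in> loopings n \<Longrightarrow> hecke_image n (looping_braid n l) \<in> carrier (mixed_hecke n)"
  by (simp add: looping_braid_eq)

lemma Lambda_closed: "Lambda n \<subseteq> carrier (mixed_hecke n)"
proof
  fix x assume "x \<in> Lambda n"
  then obtain P G where x: "x = list_prod (mixed_hecke n) (map P [1..<n+1]) \<otimes>\<^bsub>mixed_hecke n\<^esub> G"
    and P: "\<forall>i\<in>{1..n}. \<exists>ls. index ` set ls \<subseteq> {i} \<and>
      P i = list_prod (mixed_hecke n) (map (hecke_image n \<circ> looping_braid n) ls)"
    and G: "G \<in> braiding_prods n {1..<n}"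
    unfolding Lambda_def by blast
  have "P i \<in> carrier (mixed_hecke n)" if i: "i \<in> {1..n}" for i
  proof -
    obtain ls where ls: "index ` set ls \<subseteq> {i}"
      "P i = list_prod (mixed_hecke n) (map (hecke_image n \<circ> looping_braid n) ls)"
      using bspec[OF P i] by (elim exE conjE)
    have "set ls \<subseteq> loopings n" using ls(1) i by (auto simp: loopings_def)
    then show ?thesis unfolding ls(2) by (intro H.list_prod_closed) (auto simp: looping_image_closed)
  qed
  then have "list_prod (mixed_hecke n) (map P [1..<n+1]) \<in> carrier (mixed_hecke n)"
    by (intro H.list_prod_closed) auto
  then show "x \<in> carrier (mixed_hecke n)" using x G braiding_prods_closed by auto
qed

text \<open>A sorted word is the concatenation of its blocks of equal index, and the block of index
  i is the witness for \<Pi>_i.\<close>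

lemma sorted_image_Lambda:
  assumes "index ` set ls \<subseteq> {1..n}" "sorted (map index ls)" "G \<in> braiding_prods n {1..<n}"
  shows "hecke_image n (R.lword ls) \<otimes>\<^bsub>mixed_hecke n\<^esub> G \<in> Lambda n"
proof -
  let ?F = "\<lambda>i. filter (\<lambda>l. index l = i) ls"
  let ?f = "hecke_image n \<circ> looping_braid n"
  let ?P = "\<lambda>i. list_prod (mixed_hecke n) (map ?f (?F i))"
  have loop: "set ls \<subseteq> loopings n" using assms(1) by (auto simp: loopings_def)
  have closed: "hecke_image n (looping_braid n l) \<in> carrier (mixed_hecke n)" if "l \<in> set ls" for l
    using that loop by (intro looping_image_closed) auto
  have "hecke_image n (R.lword ls) = list_prod (mixed_hecke n) (map ?f ls)"
    using loop looping_braid_eq hecke_image_list_prod[of "map (looping_braid n) ls"]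
    by (auto simp: looping_prod_eq[symmetric] looping_prod_def subset_iff)
  also have "map ?f ls = map ?f (concat (map ?F [1..<n+1]))"
    using assms by (subst concat_filter_sorted) auto
  also have "map ?f (concat (map ?F [1..<n+1])) = concat (map (\<lambda>i. map ?f (?F i)) [1..<n+1])"
    by (simp only: map_concat map_map o_def)
  also have "list_prod (mixed_hecke n) \<dots> =
      list_prod (mixed_hecke n) (map (list_prod (mixed_hecke n)) (map (\<lambda>i. map ?f (?F i)) [1..<n+1]))"
  proof (rule H.list_prod_concat)
    fix xs assume "xs \<in> set (map (\<lambda>i. map ?f (?F i)) [1..<n+1])"
    then obtain i where "xs = map ?f (?F i)" by auto
    then show "set xs \<subseteq> carrier (mixed_hecke n)" using closed by auto
  qed
  also have "map (list_prod (mixed_hecke n)) (map (\<lambda>i. map ?f (?F i)) [1..<n+1]) = map ?P [1..<n+1]"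
    by (simp only: map_map o_def)
  finally have "hecke_image n (R.lword ls) = list_prod (mixed_hecke n) (map ?P [1..<n+1])" .
  moreover have "\<forall>i\<in>{1..n}. \<exists>ls'. index ` set ls' \<subseteq> {i} \<and> ?P i = list_prod (mixed_hecke n) (map ?f ls')"
    by (rule ballI, rule_tac x = "?F i" in exI) auto
  ultimately show ?thesis
    unfolding Lambda_def using assms(3) by (intro CollectI exI[of _ ?P] exI[of _ G] conjI) simp_all
qed

text \<open>Images of braids span the algebra, and every braid reduces to unsorted words on [1, n],
  then to sorted ones. Only at the end are the inverses of the g_k removed from the tail.\<close>

lemma Lambda_spans:
  assumes "n \<ge> 1"
  shows "hecke_span n (Lambda n) = carrier (mixed_hecke n)"
proof
  show "hecke_span n (Lambda n) \<subseteq> carrier (mixed_hecke n)"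
    using Lambda_closed by (rule HM.span_is_subset2)
  have sub: "submodule class_ring (hecke_span n (Lambda n)) (mixed_hecke n)"
    using Lambda_closed by (rule hecke_span_submodule)
  have sorted: "hecke_image n b \<in> hecke_span n (Lambda n)" if b: "b \<in> R.Sd N 1 n" for b N
  proof -
    obtain ls h where ls: "b = R.lword ls \<otimes>\<^bsub>mixed_braid_group n\<^esub> h" "index ` set ls \<subseteq> {1..n}"
      "sorted (map index ls)" and h: "h \<in> R.HH 1 n"
      using b unfolding R.Sd_def by auto
    have "hecke_image n (R.lword ls) \<otimes>\<^bsub>mixed_hecke n\<^esub> hecke_image n h \<otimes>\<^bsub>mixed_hecke n\<^esub> \<one>\<^bsub>mixed_hecke n\<^esub>
        \<in> hecke_span n (Lambda n)"
    proof (rule hecke_span_mult_ctxt[OF HH_image_span[OF h] braiding_prods_closed Lambda_closed])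
      fix y assume y: "y \<in> braiding_prods n {1..<n}"
      then have "y \<in> carrier (mixed_hecke n)" using braiding_prods_closed by auto
      then show "hecke_image n (R.lword ls) \<otimes>\<^bsub>mixed_hecke n\<^esub> y \<otimes>\<^bsub>mixed_hecke n\<^esub> \<one>\<^bsub>mixed_hecke n\<^esub> \<in> hecke_span n (Lambda n)"
        using hecke_span_base[OF Lambda_closed sorted_image_Lambda[OF ls(2,3) y]] by simp
    qed auto
    then show ?thesis using ls(1) h by (simp add: hecke_image_mult)
  qed
  have "hecke_image n b \<in> hecke_span n (Lambda n)" if b: "b \<in> carrier (mixed_braid_group n)" for b
  proof -
    obtain u where u: "b = word_class (mixed_gens n) (mixed_rels n) u" "u \<in> words (mixed_gens n)"
      using b by (auto simp: mixed_braid_group_def presented_group_def)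
    then obtain N where "hecke_red b (R.V N 1 n)" using wcl_red_V[OF assms] by blast
    then have "hecke_red b (R.Sd N 1 n)"
      using assms by (rule_tac R.red_trans) (auto intro!: R.red_sorted)
    then have "hecke_image n b \<in> hecke_span n (hecke_image n ` (R.Sd N 1 n \<inter> carrier (mixed_braid_group n)))"
      unfolding hecke_red_def by simp
    moreover have "hecke_span n (hecke_image n ` (R.Sd N 1 n \<inter> carrier (mixed_braid_group n))) \<subseteq> hecke_span n (Lambda n)"
      using sub sorted by (intro HM.span_is_subset) auto
    ultimately show ?thesis by blast
  qed
  then have "hecke_span n (hecke_image n ` carrier (mixed_braid_group n)) \<subseteq> hecke_span n (Lambda n)"
    using sub by (intro HM.span_is_subset) auto
  then show "carrier (mixed_hecke n) \<subseteq> hecke_span n (Lambda n)"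
    using hecke_carrier_span by blast
qed

end

theorem theorem1:
  fixes n :: nat
  assumes "n \<ge> 1"
  shows
    "(\<forall>ls k m M w.
        k \<ge> 1 \<and> length ls = k \<and> set ls \<subseteq> loopings n \<and> w = looping_prod n ls \<and>
        m = Min (index ` set ls) \<and> M = Max (index ` set ls) \<longrightarrow>
        hecke_image n w \<in> hecke_span n
          {hecke_image n w' \<otimes>\<^bsub>mixed_hecke n\<^esub> G | w' G.
             (\<exists>ls'. w' = looping_prod n ls' \<and> length ls' = k \<and> set ls' \<subseteq> loopings n \<and>
                index ` set ls' \<subseteq> {m..M} \<and> sorted (map index ls')) \<and>
             (if m < M then G \<in> signed_braiding_prods n {m..M-1} else G = \<one>\<^bsub>mixed_hecke n\<^esub>)}) \<and>
     hecke_span n (Lambda n) = carrier (mixed_hecke n)"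
proof (intro conjI allI impI, elim conjE)
  fix ls k m M w
  assume ls: "k \<ge> 1" "length ls = k" "set ls \<subseteq> loopings n" and w: "w = looping_prod n ls"
    and mM: "m = Min (index ` set ls)" "M = Max (index ` set ls)"
  have "ls \<noteq> []" using ls by auto
  from looping_prod_sorted_span[OF ls(3) this]
  show "hecke_image n w \<in> hecke_span n
          {hecke_image n w' \<otimes>\<^bsub>mixed_hecke n\<^esub> G | w' G.
             (\<exists>ls'. w' = looping_prod n ls' \<and> length ls' = k \<and> set ls' \<subseteq> loopings n \<and>
                index ` set ls' \<subseteq> {m..M} \<and> sorted (map index ls')) \<and>
             (if m < M then G \<in> signed_braiding_prods n {m..M-1} else G = \<one>\<^bsub>mixed_hecke n\<^esub>)}"
    unfolding w mM ls(2)[symmetric] .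
qed (rule Lambda_spans[OF assms])

end
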